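(* Let $N\ge1$, $\omega_1,\dots,\omega_N\in\mathbb{R}$, $\kappa>0$ and $\varepsilon\in(0,1]$ with $\kappa>(2+\varepsilon)\|\Omega\|_\infty$, where $\|\Omega\|_\infty=\max_i|\omega_i|$. For initial data $(\theta_i^0)_{i=1}^N$ let $(\theta_i(t))_{i=1}^N$ solve \[ \dot\theta_i=\omega_i-\frac{\kappa}{N}\sum_{j=1}^N(1+\cos\theta_j)\sin\theta_i,\qquad\theta_i(0)=\theta_i^0, \] and let $R(t)=\frac1N\sum_j(1+\cos\theta_j(t))$. Let $m$ be the normalized Lebesgue measure on $[-\pi,\pi]^N$ ($m([-\pi,\pi]^N)=1$). Then the $m$-measure of the set of initial data $(\theta_i^0)\in[-\pi,\pi]^N$ such that (i) $R(t)\ge\frac1{\sqrt2}-\frac{3\varepsilon}{20}$ for all $t\ge0$; (ii) $\sup_{t\ge0}\theta_i(t)-\inf_{t\ge0}\theta_i(t)<2\pi$ for all $i$; and (iii) for every $i$ and every $t_0\ge0$ with $\cos\theta_i(t_0)\ge-\frac1{\sqrt2}$, one has $\cos\theta_i(t)\ge-\frac1{\sqrt2}$ for all $t\ge t_0$ and $\cos\theta_i(t)\ge\frac1{\sqrt2}$ for all $t\ge t_0+\frac{(2+\varepsilon)\pi}{\kappa-(2+\varepsilon)\|\Omega\|_\infty}$, is at least $1-\exp\left(-\frac{\varepsilon^2N}{25}\right)$. If in addition $\kappa>\left(\frac{\pi e}{2}\right)^{3/2}\|\Omega\|_\infty$, then \[ m\Big\{(\theta_i^0)\in[-\pi,\pi]^N:\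 \sup_{t\ge0}\theta_i(t)-\inf_{t\ge0}\theta_i(t)<2\pi\ \text{for all } i\Big\}\ge1-\left(\sqrt{\frac{\pi e}{2}}\,\frac{\|\Omega\|_\infty^{1/3}}{\kappa^{1/3}}\right)^N. \] *)

theory Defs
  imports "HOL-Analysis.Analysis"
begin

definition Omega_inf :: "real^'n \<Rightarrow> real" where
  "Omega_inf \<omega> = Max (range (\<lambda>i. \<bar>\<omega> $ i\<bar>))"

definition kura_rhs :: "real \<Rightarrow> real^'n \<Rightarrow> real^'n \<Rightarrow> real^'n" where
  "kura_rhs \<kappa> \<omega> x = (\<chi> i. \<omega> $ i
      - (\<kappa> / real CARD('n)) * (\<Sum>j\<in>UNIV. 1 + cos (x $ j)) * sin (x $ i))"

definition is_solution :: "real \<Rightarrow> real^'n \<Rightarrow> real^'n \<Rightarrow> (real \<Rightarrow> real^'n) \<Rightarrow> bool" where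
  "is_solution \<kappa> \<omega> \<theta>0 \<theta> \<longleftrightarrow> \<theta> 0 = \<theta>0 \<and>
     (\<forall>t\<ge>0. (\<theta> has_vector_derivative kura_rhs \<kappa> \<omega> (\<theta> t)) (at t within {0..}))"

definition order_R :: "(real \<Rightarrow> real^'n) \<Rightarrow> real \<Rightarrow> real" where
  "order_R \<theta> t = (1 / real CARD('n)) * (\<Sum>j\<in>UNIV. 1 + cos (\<theta> t $ j))"

definition cube :: "(real^'n) set" where
  "cube = {x. \<forall>i. x $ i \<in> {-pi..pi}}"

definition norm_meas :: "(real^'n) set \<Rightarrow> real" where
  "norm_meas S = measure lebesgue S / (2 * pi) ^ CARD('n)"

definition osc_bounded :: "(real \<Rightarrow> real^'n) \<Rightarrow> 'n \<Rightarrow> bool" where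
  "osc_bounded \<theta> i \<longleftrightarrow>
     bdd_above ((\<lambda>t. \<theta> t $ i) ` {0..}) \<and> bdd_below ((\<lambda>t. \<theta> t $ i) ` {0..}) \<and>
     (SUP t\<in>{0..}. \<theta> t $ i) - (INF t\<in>{0..}. \<theta> t $ i) < 2 * pi"

end

theory Submission
  imports Defs "HOL-Probability.Distributions"
begin

text \<open>
  Suppose the order parameter stays above a level \<open>r\<close> with \<open>\<kappa> * r * sin \<alpha> > Omega_inf \<omega>\<close>. Then each
  phase is pushed towards \<open>0\<close> whenever it is outside the \<open>\<alpha>\<close>-neighbourhoods of the multiples of \<open>pi\<close>.
  Hence an oscillator not initially within \<open>\<alpha>\<close> of \<open>pi\<close> keeps \<open>1 + cos\<close> above the smaller of its
  initial value and \<open>1 + cos \<alpha>\<close>, and if the average of these guaranteed amounts exceeds \<open>r\<close>, a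
  continuity argument shows that the order parameter never falls to \<open>r\<close>. The bound on oscillations
  and the trapping property follow from the same barriers.

  The guaranteed amounts are functions of the independent initial phases, so a Chernoff bound
  estimates the measure of the exceptional set: with \<open>\<alpha> = pi/4\<close> for the first claim, and for the
  second with \<open>cos \<alpha> = 1 - q\<^sup>2\<close>, \<open>r = q\<^sup>2\<close>, \<open>q\<^sup>3 = Omega_inf \<omega> / \<kappa>\<close>, where the exceptional
  set is contained in the set where the initial order parameter is at most \<open>2 * q\<^sup>2\<close>.

  Measurability holds because limits of solutions are solutions (Gronwall), so closed conditions on
  solutions cut out closed sets of initial data.
\<close>

subsection \<open>Barriers for a single phase\<close>

lemma compact_sublevel_Icc:
  fixes f :: "real \<Rightarrow> real"
  assumes "continuous_on {a..b} f"
  shows "compact {t \<in> {a..b}. f t \<le> c}"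
proof -
  have "{t \<in> {a..b}. f t \<le> c} = {a..b} \<inter> f -` {..c}" by auto
  then have "closed {t \<in> {a..b}. f t \<le> c}"
    using continuous_closed_preimage[OF assms, of "{..c}"] by simp
  moreover have "bounded {t \<in> {a..b}. f t \<le> c}"
    by (rule bounded_subset[of "{a..b}"]) auto
  ultimately show ?thesis by (simp add: compact_eq_bounded_closed)
qed

text \<open>At the last time \<open>s\<close> with \<open>y s \<le> c\<close>, continuity forces
  \<open>y s = c\<close>; the negative derivative there pushes \<open>y\<close> below
  \<open>c\<close> immediately afterwards, contradicting the choice of \<open>s\<close>.\<close>

lemma barrier_above:
  fixes y y' :: "real \<Rightarrow> real"
  assumes der: "\<And>t. t \<in> {a..b} \<Longrightarrow> (y has_real_derivative y' t) (at t within {a..b})"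
    and inward: "\<And>t. t \<in> {a..b} \<Longrightarrow> y t = c \<Longrightarrow> y' t < 0"
    and start: "y a \<le> c" and "a \<le> b"
  shows "y b \<le> c"
proof (rule ccontr)
  assume "\<not> y b \<le> c"
  then have yb: "y b > c" by simp
  have cont: "continuous_on {a..b} y"
    using der by (meson DERIV_continuous_on)
  define A where "A = {t \<in> {a..b}. y t \<le> c}"
  have "compact A" unfolding A_def by (rule compact_sublevel_Icc) (rule cont)
  moreover have "A \<noteq> {}" using start \<open>a \<le> b\<close> by (auto simp: A_def)
  ultimately obtain s where s: "s \<in> A" and max: "\<And>t. t \<in> A \<Longrightarrow> t \<le> s"
    using compact_attains_sup by meson
  have sab: "a \<le> s" "s < b" "y s \<le> c" using s yb by (auto simp: A_def less_le)
  have after: "y t > c" if "s < t" "t \<le> b" for t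
    using max[of t] that sab by (force simp: A_def)
  have "y s = c"
  proof (rule ccontr)
    assume "y s \<noteq> c"
    moreover have "continuous_on {s..b} y"
      by (rule continuous_on_subset[OF cont]) (use sab in auto)
    ultimately obtain u where "s \<le> u" "u \<le> b" "y u = c"
      using IVT'[of y s c b] sab yb by auto
    with after[of u] \<open>y s \<noteq> c\<close> show False by (cases "u = s") auto
  qed
  then have "y' s < 0" using inward sab by auto
  then obtain d where d: "d > 0" "\<And>h. h > 0 \<Longrightarrow> s + h \<in> {a..b} \<Longrightarrow> h < d \<Longrightarrow> y s > y (s + h)"
    using has_real_derivative_neg_dec_right[OF der, of s] sab by auto
  define h where "h = min (d/2) (b - s)"
  have "h > 0" "h < d" "s + h \<in> {a..b}" "s < s + h" "s + h \<le> b"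
    using d(1) sab by (auto simp: h_def)
  with d(2)[of h] after[of "s+h"] \<open>y s = c\<close> show False by auto
qed

lemma sin_le_sin_between:
  assumes "0 < \<alpha>" "\<alpha> < pi/2" "\<alpha> \<le> x" "x \<le> pi - \<alpha>"
  shows "sin \<alpha> \<le> sin x"
proof (cases "x \<le> pi/2")
  case True
  then show ?thesis using assms by (intro sin_monotone_2pi_le) auto
next
  case False
  then have "sin \<alpha> \<le> sin (pi - x)" using assms by (intro sin_monotone_2pi_le) auto
  then show ?thesis by simp
qed

text \<open>One oscillator as a scalar equation whose coupling \<open>p\<close> will be
  \<open>\<kappa>\<close> times the order parameter. \<open>J\<close> is a general interval because
  the barriers serve twice: on \<open>{0..T}\<close> inside the continuity argument, and on
  \<open>{0..}\<close> once the lower bound is global.\<close>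

locale driven_phase =
  fixes J :: "real set" and y p :: "real \<Rightarrow> real" and w p0 \<alpha> :: real
  assumes interval: "is_interval J"
    and alpha: "0 < \<alpha>" "\<alpha> < pi/2"
    and der: "\<And>t. t \<in> J \<Longrightarrow> (y has_real_derivative w - p t * sin (y t)) (at t within J)"
    and coupling: "\<And>t. t \<in> J \<Longrightarrow> p0 \<le> p t"
    and strong: "\<bar>w\<bar> < p0 * sin \<alpha>"
begin

lemma sin_alpha: "0 < sin \<alpha>"
  using alpha by (intro sin_gt_zero) auto

lemma p0_pos: "0 < p0"
  using strong sin_alpha by (smt (verit) zero_less_mult_pos2)

lemma Icc_subset: "s \<in> J \<Longrightarrow> t \<in> J \<Longrightarrow> {s..t} \<subseteq> J"
  using interval unfolding is_interval_1 by (meson atLeastAtMost_iff subsetI)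

lemma der_Icc:
  "s \<in> J \<Longrightarrow> t \<in> J \<Longrightarrow> u \<in> {s..t} \<Longrightarrow> (y has_real_derivative w - p u * sin (y u)) (at u within {s..t})"
  by (rule DERIV_subset[OF der]) (use Icc_subset in blast)+

text \<open>The constant \<open>p0 * sin \<alpha> - \<bar>w\<bar>\<close> is a uniform speed of
  descent; its sign gives the barriers and its size the trapping time.\<close>

lemma velocity_le:
  assumes "t \<in> J" "sin \<alpha> \<le> sin (y t)"
  shows "w - p t * sin (y t) \<le> - (p0 * sin \<alpha> - \<bar>w\<bar>)"
proof -
  have "p0 * sin \<alpha> \<le> p t * sin (y t)"
    using assms coupling[of t] p0_pos sin_alpha by (intro mult_mono) auto
  then show ?thesis by simp
qed

lemma stays_below:
  assumes "s \<in> J" "t \<in> J" "s \<le> t" "sin \<alpha> \<le> sin c" "y s \<le> c"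
  shows "y t \<le> c"
proof (rule barrier_above[where y = y and a = s])
  show "(y has_real_derivative w - p u * sin (y u)) (at u within {s..t})" if "u \<in> {s..t}" for u
    using der_Icc assms that by blast
  show "w - p u * sin (y u) < 0" if "u \<in> {s..t}" "y u = c" for u
    using velocity_le[of u] that assms Icc_subset[of s t] strong by auto
qed (use assms in auto)

text \<open>The symmetry \<open>y\<close>, \<open>w\<close> to \<open>- y\<close>,
  \<open>- w\<close> turns every upper barrier into a lower one.\<close>

lemma reflected: "driven_phase J (\<lambda>t. - y t) p (- w) p0 \<alpha>"
proof
  fix t assume "t \<in> J"
  then show "((\<lambda>t. - y t) has_real_derivative - w - p t * sin (- y t)) (at t within J)"
    using DERIV_minus[OF der] by simp
qed (use interval alpha coupling strong in auto)

lemma shifted: "driven_phase J (\<lambda>t. y t + 2 * pi * of_int k) p w p0 \<alpha>"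
proof
  fix t assume "t \<in> J"
  moreover have "sin (y t + 2 * pi * of_int k) = sin (y t)"
    by (simp add: sin_add sin_int_2pin cos_int_2pin)
  ultimately show "((\<lambda>t. y t + 2 * pi * of_int k) has_real_derivative
      w - p t * sin (y t + 2 * pi * of_int k)) (at t within J)"
    by (auto intro!: derivative_eq_intros der)
qed (use interval alpha coupling strong in auto)

lemma stays_above:
  assumes "s \<in> J" "t \<in> J" "s \<le> t" "sin c \<le> - sin \<alpha>" "c \<le> y s"
  shows "c \<le> y t"
  using driven_phase.stays_below[OF reflected, of s t "-c"] assms by simp

text \<open>The level \<open>max \<bar>y s\<bar> \<alpha>\<close> lies between
  \<open>\<alpha>\<close> and \<open>pi - \<alpha>\<close>, so it is an upper barrier and its
  negative a lower one.\<close>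

lemma abs_le_max:
  assumes "s \<in> J" "t \<in> J" "s \<le> t" "\<bar>y s\<bar> \<le> pi - \<alpha>"
  shows "\<bar>y t\<bar> \<le> max \<bar>y s\<bar> \<alpha>"
proof -
  have "sin \<alpha> \<le> sin (max \<bar>y s\<bar> \<alpha>)"
    using assms alpha by (intro sin_le_sin_between) auto
  then show ?thesis
    using stays_below[of s t "max \<bar>y s\<bar> \<alpha>"] stays_above[of s t "- max \<bar>y s\<bar> \<alpha>"] assms
    by (simp add: abs_le_iff) linarith
qed

text \<open>If \<open>y t > \<alpha>\<close>, the barriers at \<open>\<alpha>\<close> and
  \<open>pi - \<alpha>\<close> keep \<open>y\<close> between these levels on all of
  \<open>{s..t}\<close>. There it descends at the uniform speed, and by time \<open>t\<close> it
  would have covered the whole width \<open>pi - 2 * \<alpha>\<close>.\<close>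

lemma le_alpha_after:
  assumes "s \<in> J" "t \<in> J" "s \<le> t" "y s \<le> pi - \<alpha>"
    and late: "pi - 2 * \<alpha> \<le> (p0 * sin \<alpha> - \<bar>w\<bar>) * (t - s)"
  shows "y t \<le> \<alpha>"
proof (rule ccontr)
  assume "\<not> y t \<le> \<alpha>"
  then have gt: "y t > \<alpha>" by simp
  have "s \<noteq> t" using late alpha by auto
  then have "s < t" using assms by simp
  have between: "\<alpha> \<le> y u \<and> y u \<le> pi - \<alpha>" if "u \<in> {s..t}" for u
  proof -
    have "u \<in> J" using that Icc_subset assms(1,2) by blast
    then show ?thesis
      using stays_below[of u t \<alpha>] stays_below[of s u "pi - \<alpha>"] that gt assms by force
  qed
  obtain u where u: "u \<in> {s<..<t}" "y t - y s = (w - p u * sin (y u)) * (t - s)"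
    using mvt_simple[OF \<open>s < t\<close>, of y "\<lambda>u. (*) (w - p u * sin (y u))"] der_Icc[OF assms(1,2)]
    unfolding has_field_derivative_def by auto
  have "w - p u * sin (y u) \<le> - (p0 * sin \<alpha> - \<bar>w\<bar>)"
    using between[of u] u Icc_subset[OF assms(1,2)] alpha
    by (intro velocity_le sin_le_sin_between) auto
  then have "y t - y s \<le> - (p0 * sin \<alpha> - \<bar>w\<bar>) * (t - s)"
    unfolding u(2) using \<open>s < t\<close> by (intro mult_right_mono) auto
  then show False using late gt assms by (simp add: algebra_simps)
qed

lemma abs_le_alpha_after:
  assumes "s \<in> J" "t \<in> J" "s \<le> t" "\<bar>y s\<bar> \<le> pi - \<alpha>"
    and late: "pi - 2 * \<alpha> \<le> (p0 * sin \<alpha> - \<bar>w\<bar>) * (t - s)"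
  shows "\<bar>y t\<bar> \<le> \<alpha>"
  using le_alpha_after[of s t] driven_phase.le_alpha_after[OF reflected, of s t] assms
  by (auto simp: abs_le_iff)

text \<open>A phase that starts within \<open>\<alpha>\<close> of \<open>pi\<close> either drops below \<open>pi - \<alpha>\<close> and then never
  climbs to \<open>pi + \<alpha>\<close> again, or vice versa; so only one of the two adjacent wells is visited.\<close>

lemma oscillation_near_pi:
  assumes "s0 \<in> J" "\<And>t. t \<in> J \<Longrightarrow> s0 \<le> t" "pi - \<alpha> \<le> y s0" "y s0 \<le> pi + \<alpha>" "s \<in> J" "t \<in> J"
  shows "y s - y t \<le> pi + 2 * \<alpha>"
proof -
  have sin_eqs: "sin (pi - \<alpha>) = sin \<alpha>" "sin (2 * pi + \<alpha>) = sin \<alpha>" "sin (pi + \<alpha>) = - sin \<alpha>"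
    by (simp_all add: sin_add)
  show ?thesis
  proof (cases "\<exists>u\<in>J. pi + \<alpha> \<le> y u")
    case True
    then obtain u where u: "u \<in> J" "pi + \<alpha> \<le> y u" by auto
    \<comment> \<open>Before \<open>u\<close>, a value below \<open>pi - \<alpha>\<close> could
      never climb to \<open>y u\<close>; after \<open>u\<close>, the level
      \<open>pi + \<alpha>\<close> is a lower barrier.\<close>
    have "pi - \<alpha> \<le> y v" if "v \<in> J" for v
    proof (cases "v \<le> u")
      case True
      then show ?thesis
        using stays_below[of v u "pi - \<alpha>"] that u alpha sin_eqs by force
    next
      case False
      then show ?thesis
        using stays_above[of u v "pi + \<alpha>"] that u alpha sin_eqs by force
    qed
    moreover have "y v \<le> 2 * pi + \<alpha>" if "v \<in> J" for v
      using stays_below[of s0 v "2 * pi + \<alpha>"] that assms alpha sin_eqs by force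
    ultimately show ?thesis using assms(5,6) by (smt (verit))
  next
    case False
    then have "y s \<le> pi + \<alpha>" using assms(5) by force
    moreover have "- \<alpha> \<le> y t"
      using stays_above[of s0 t "- \<alpha>"] assms alpha by force
    ultimately show ?thesis by simp
  qed
qed

text \<open>The start is either in the well around \<open>0\<close> or within
  \<open>\<alpha>\<close> of \<open>pi\<close> or \<open>- pi\<close>, the last case by reflection.
  Both terms of the maximum are below \<open>2 * pi\<close> because
  \<open>0 < \<alpha> < pi/2\<close>.\<close>

lemma oscillation_le:
  assumes "s0 \<in> J" "\<And>t. t \<in> J \<Longrightarrow> s0 \<le> t" "\<bar>y s0\<bar> \<le> pi" "s \<in> J" "t \<in> J"
  shows "y s - y t \<le> max (2 * pi - 2 * \<alpha>) (pi + 2 * \<alpha>)"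
proof -
  consider "\<bar>y s0\<bar> \<le> pi - \<alpha>" | "pi - \<alpha> \<le> y s0" | "pi - \<alpha> \<le> - y s0" by linarith
  then show ?thesis
  proof cases
    case 1
    then have "\<bar>y u\<bar> \<le> pi - \<alpha>" if "u \<in> J" for u
      using abs_le_max[of s0 u] that assms alpha by auto
    from this[of s] this[of t] show ?thesis using assms by simp
  next
    case 2
    then show ?thesis using oscillation_near_pi[of s0 s t] assms alpha by auto
  next
    case 3
    then show ?thesis
      using driven_phase.oscillation_near_pi[OF reflected, of s0 t s] assms alpha by auto
  qed
qed

end

text \<open>At the first time \<open>T\<close> with \<open>R T \<le> c\<close> the weak bound
  \<open>c \<le> R\<close> still holds on all of \<open>{0..T}\<close>, so \<open>improve\<close>
  makes it strict at \<open>T\<close>, a contradiction.\<close>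

lemma bootstrap_lower_bound:
  fixes R :: "real \<Rightarrow> real"
  assumes cont: "continuous_on {0..} R" and start: "R 0 > c"
    and improve: "\<And>T. T \<ge> 0 \<Longrightarrow> (\<And>t. t \<in> {0..T} \<Longrightarrow> c \<le> R t) \<Longrightarrow> c < R T"
    and "t \<ge> 0"
  shows "c < R t"
proof (rule ccontr)
  assume "\<not> c < R t"
  define A where "A = {s \<in> {0..t}. R s \<le> c}"
  have cont_t: "continuous_on {0..s} R" for s by (rule continuous_on_subset[OF cont]) auto
  have "compact A" unfolding A_def by (rule compact_sublevel_Icc) (rule cont_t)
  moreover have "A \<noteq> {}" using \<open>\<not> c < R t\<close> \<open>t \<ge> 0\<close> by (auto simp: A_def)
  ultimately obtain T where T: "T \<in> A" and min: "\<And>s. s \<in> A \<Longrightarrow> T \<le> s"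
    using compact_attains_inf by meson
  have before: "c < R s" if "0 \<le> s" "s < T" for s
    using min[of s] that T by (force simp: A_def)
  obtain u where u: "0 \<le> u" "u \<le> T" "R u = c"
    using IVT2'[of R T c 0] T start cont_t[of T] by (auto simp: A_def)
  have "u = T" using before[of u] u by force
  then have "c < R T"
    using u T before by (intro improve) (force simp: A_def le_less)+
  then show False using T by (simp add: A_def)
qed

subsection \<open>Dependence on initial data and measurability\<close>

text \<open>Gronwall: \<open>exp (-2 * L * s)\<close> times the squared distance does not increase,
  by Cauchy-Schwarz and the Lipschitz bound. The squared norm is differentiable even where the
  solutions meet.\<close>

lemma norm_diff_solutions_le:
  fixes F :: "'a::real_inner \<Rightarrow> 'a"
  assumes lip: "\<And>x y. norm (F x - F y) \<le> L * norm (x - y)"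
    and u: "\<And>t. t \<ge> 0 \<Longrightarrow> (u has_vector_derivative F (u t)) (at t within {0..})"
    and v: "\<And>t. t \<ge> 0 \<Longrightarrow> (v has_vector_derivative F (v t)) (at t within {0..})"
    and "t \<ge> 0"
  shows "norm (u t - v t) \<le> exp (L * t) * norm (u 0 - v 0)"
proof (cases "t = 0")
  case False
  define h where "h = (\<lambda>s. exp (-2 * L * s) * ((u s - v s) \<bullet> (u s - v s)))"
  define h' where "h' = (\<lambda>s. exp (-2 * L * s) *
      (2 * ((u s - v s) \<bullet> (F (u s) - F (v s))) - 2 * L * ((u s - v s) \<bullet> (u s - v s))))"
  have der: "(h has_derivative (\<lambda>z. h' s * z)) (at s within {0..t})" if "0 \<le> s" "s \<le> t" for s
  proof -
    have us: "(u has_derivative (\<lambda>z. z *\<^sub>R F (u s))) (at s within {0..t})"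
      and vs: "(v has_derivative (\<lambda>z. z *\<^sub>R F (v s))) (at s within {0..t})"
      using has_vector_derivative_within_subset[OF u, of s "{0..t}"]
        has_vector_derivative_within_subset[OF v, of s "{0..t}"] that
      by (auto simp: has_vector_derivative_def)
    show ?thesis
      unfolding h_def h'_def
      by (rule derivative_eq_intros us vs refl)+
        (auto simp: algebra_simps inner_diff inner_commute)
  qed
  obtain s where s: "s \<in> {0<..<t}" "h t - h 0 = h' s * (t - 0)"
    using mvt_simple[of 0 t h "\<lambda>s z. h' s * z"] der False \<open>t \<ge> 0\<close> by auto
  have "(u s - v s) \<bullet> (F (u s) - F (v s)) \<le> norm (u s - v s) * norm (F (u s) - F (v s))"
    by (rule norm_cauchy_schwarz)
  also have "\<dots> \<le> norm (u s - v s) * (L * norm (u s - v s))"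
    by (intro mult_left_mono lip) auto
  finally have "h' s \<le> 0"
    unfolding h'_def by (intro mult_nonneg_nonpos) (auto simp: dot_square_norm power2_eq_square algebra_simps)
  then have "h t \<le> h 0"
    using s mult_nonpos_nonneg[of "h' s" t] by auto
  moreover have "h s = (exp (- (L * s)) * norm (u s - v s))\<^sup>2" for s
    using exp_double[of "- (L * s)"]
    by (simp add: h_def dot_square_norm power_mult_distrib mult.assoc)
  ultimately have "(exp (- (L * t)) * norm (u t - v t))\<^sup>2 \<le> (norm (u 0 - v 0))\<^sup>2" by simp
  then have "exp (- (L * t)) * norm (u t - v t) \<le> norm (u 0 - v 0)"
    by (rule power2_le_imp_le) simp
  then show ?thesis by (simp add: exp_minus field_simps)
qed simp

text \<open>By the Gronwall bound, convergence of the initial values gives convergence uniform on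
  bounded time intervals. The derivatives \<open>F (u n s)\<close> then converge uniformly as well,
  so the limit can be differentiated.\<close>

lemma limit_of_solutions:
  fixes F :: "'a::euclidean_space \<Rightarrow> 'a"
  assumes lip: "\<And>x y. norm (F x - F y) \<le> L * norm (x - y)" and "L \<ge> 0"
    and u: "\<And>n t. t \<ge> 0 \<Longrightarrow> (u n has_vector_derivative F (u n t)) (at t within {0..})"
    and lim0: "(\<lambda>n. u n 0) \<longlonglongrightarrow> x"
  obtains v where "\<And>t. t \<ge> 0 \<Longrightarrow> (\<lambda>n. u n t) \<longlonglongrightarrow> v t"
    and "\<And>t. t \<ge> 0 \<Longrightarrow> (v has_vector_derivative F (v t)) (at t within {0..})"
proof -
  have dep: "norm (u n t - u m t) \<le> exp (L * t) * norm (u n 0 - u m 0)" if "t \<ge> 0" for n m t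
    by (rule norm_diff_solutions_le[OF lip u u that])
  have "Cauchy (\<lambda>n. u n t)" if "t \<ge> 0" for t
  proof (rule CauchyI)
    fix e :: real assume "e > 0"
    then have "e / exp (L * t) > 0" by simp
    then obtain M where M: "\<forall>m\<ge>M. \<forall>n\<ge>M. norm (u m 0 - u n 0) < e / exp (L * t)"
      using LIMSEQ_imp_Cauchy[OF lim0] by (meson CauchyD)
    then have "norm (u m t - u n t) < e" if "m \<ge> M" "n \<ge> M" for m n
      using dep[OF \<open>t \<ge> 0\<close>, of m n] M that by (fastforce simp: field_simps)
    then show "\<exists>M. \<forall>m\<ge>M. \<forall>n\<ge>M. norm (u m t - u n t) < e" by blast
  qed
  then have "\<forall>t\<in>{0..}. \<exists>l. (\<lambda>n. u n t) \<longlonglongrightarrow> l"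
    by (auto simp: Cauchy_convergent_iff convergent_def)
  then obtain v where v: "\<And>t. t \<ge> 0 \<Longrightarrow> (\<lambda>n. u n t) \<longlonglongrightarrow> v t"
    by (metis atLeast_iff)
  have dist_v: "norm (u n t - v t) \<le> exp (L * t) * norm (u n 0 - x)" if "t \<ge> 0" for n t
    by (rule LIMSEQ_le[of "\<lambda>m. norm (u n t - u m t)" _ "\<lambda>m. exp (L * t) * norm (u n 0 - u m 0)"])
       (auto intro!: tendsto_intros v that lim0 dep)
  have "(v has_vector_derivative F (v t)) (at t within {0..})" if "t \<ge> 0" for t
  proof -
    \<comment> \<open>Uniformity needs a bounded interval; with \<open>T > t\<close> the derivative
      at \<open>t\<close> within \<open>{0..T}\<close> is the one within
      \<open>{0..}\<close>.\<close>
    define T where "T = t + 1"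
    have "\<exists>g. \<forall>s\<in>{0..T}. (\<lambda>n. u n s) \<longlonglongrightarrow> g s \<and> (g has_derivative (\<lambda>h. h *\<^sub>R F (v s))) (at s within {0..T})"
    proof (rule has_derivative_sequence[where f' = "\<lambda>n s h. h *\<^sub>R F (u n s)" and ?x0.0 = 0])
      show "(u n has_derivative (\<lambda>h. h *\<^sub>R F (u n s))) (at s within {0..T})" if "s \<in> {0..T}" for n s
        using has_vector_derivative_within_subset[OF u, of s "{0..T}" n] that
        by (auto simp: has_vector_derivative_def)
      fix e :: real assume "e > 0"
      have "(\<lambda>n. L * (exp (L * T) * norm (u n 0 - x))) \<longlonglongrightarrow> L * (exp (L * T) * norm (x - x))"
        by (intro tendsto_intros lim0)
      then have "\<forall>\<^sub>F n in sequentially. L * (exp (L * T) * norm (u n 0 - x)) < e"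
        by (rule order_tendstoD(2)) (use \<open>e > 0\<close> in auto)
      then show "\<forall>\<^sub>F n in sequentially. \<forall>s\<in>{0..T}. \<forall>h. norm (h *\<^sub>R F (u n s) - h *\<^sub>R F (v s)) \<le> e * norm h"
      proof eventually_elim
        case (elim n)
        show ?case
        proof (intro ballI allI)
          fix s h :: real assume s: "s \<in> {0..T}"
          have "norm (F (u n s) - F (v s)) \<le> L * norm (u n s - v s)" by (rule lip)
          also have "\<dots> \<le> L * (exp (L * s) * norm (u n 0 - x))"
            using s \<open>L \<ge> 0\<close> by (intro mult_left_mono dist_v) auto
          also have "\<dots> \<le> L * (exp (L * T) * norm (u n 0 - x))"
            using s \<open>L \<ge> 0\<close> by (intro mult_left_mono mult_right_mono) (auto intro: mult_left_mono)
          finally have "norm (F (u n s) - F (v s)) \<le> e" using elim by simp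
          then have "\<bar>h\<bar> * norm (F (u n s) - F (v s)) \<le> \<bar>h\<bar> * e" by (intro mult_left_mono) auto
          then show "norm (h *\<^sub>R F (u n s) - h *\<^sub>R F (v s)) \<le> e * norm h"
            by (simp add: mult.commute flip: scaleR_diff_right)
        qed
      qed
    qed (use lim0 that in \<open>auto simp: T_def\<close>)
    then obtain g where g: "\<And>s. s \<in> {0..T} \<Longrightarrow> (\<lambda>n. u n s) \<longlonglongrightarrow> g s"
        "\<And>s. s \<in> {0..T} \<Longrightarrow> (g has_vector_derivative F (v s)) (at s within {0..T})"
      unfolding has_vector_derivative_def by blast
    have gv: "g s = v s" if "s \<in> {0..T}" for s
      using LIMSEQ_unique[OF g(1)[OF that] v] that by auto
    have "t \<in> {0..T}" using that by (simp add: T_def)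
    then have "(v has_vector_derivative F (v t)) (at t within {0..T})"
      using gv by (intro has_vector_derivative_transform[OF _ _ g(2)]) auto
    moreover have "at t within {0..T} = at t within {0..}"
      by (rule at_within_nhd[where S = "{..<T}"]) (auto simp: T_def)
    ultimately show ?thesis by simp
  qed
  with v that show thesis by blast
qed

section \<open>Lipschitz continuity of the vector field\<close>

lemma abs_sin_diff_le: "\<bar>sin x - sin y\<bar> \<le> \<bar>x - y\<bar>" for x y :: real
proof -
  have "\<bar>sin ((x - y) / 2)\<bar> * \<bar>cos ((x + y) / 2)\<bar> \<le> \<bar>(x - y) / 2\<bar> * 1"
    by (intro mult_mono abs_sin_x_le_abs_x) auto
  then show ?thesis unfolding sin_diff_sin by (simp add: abs_mult)
qed

lemma abs_cos_diff_le: "\<bar>cos x - cos y\<bar> \<le> \<bar>x - y\<bar>" for x y :: real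
  using abs_sin_diff_le[of "pi/2 - x" "pi/2 - y"] by (simp add: sin_diff)

text \<open>Each component has Lipschitz constant \<open>3 * \<kappa>\<close>: one part from varying
  the cosine sum, two from varying the sine, as the sum is at most \<open>2 * CARD('n)\<close>.
  Passing to the norm through the sum of components costs the factor
  \<open>CARD('n)\<close>.\<close>

lemma kura_rhs_lipschitz:
  fixes x y :: "real^'n"
  assumes "\<kappa> > 0"
  shows "norm (kura_rhs \<kappa> \<omega> x - kura_rhs \<kappa> \<omega> y) \<le> (3 * \<kappa> * real CARD('n)) * norm (x - y)"
proof -
  let ?N = "real CARD('n)"
  define S where "S = (\<lambda>x::real^'n. \<Sum>j\<in>UNIV. 1 + cos (x $ j))"
  have comp: "\<bar>x $ i - y $ i\<bar> \<le> norm (x - y)" for i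
    using component_le_norm_cart[of "x - y" i] by simp
  have "\<bar>S x - S y\<bar> \<le> (\<Sum>j\<in>UNIV. \<bar>cos (x $ j) - cos (y $ j)\<bar>)"
    unfolding S_def sum_subtractf[symmetric] by (rule order_trans[OF sum_abs]) simp
  also have "\<dots> \<le> (\<Sum>j\<in>(UNIV::'n set). norm (x - y))"
    by (intro sum_mono order_trans[OF abs_cos_diff_le comp])
  finally have S_diff: "\<bar>S x - S y\<bar> \<le> ?N * norm (x - y)" by simp
  have "\<bar>S y\<bar> \<le> (\<Sum>j\<in>(UNIV::'n set). 2)"
    unfolding S_def by (rule order_trans[OF sum_abs sum_mono]) (simp add: abs_le_iff, smt (verit) cos_le_one cos_ge_minus_one)
  then have S_le: "\<bar>S y\<bar> \<le> 2 * ?N" by simp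
  have each: "\<bar>(kura_rhs \<kappa> \<omega> x - kura_rhs \<kappa> \<omega> y) $ i\<bar> \<le> 3 * \<kappa> * norm (x - y)" for i
  proof -
    have "S x * sin (x $ i) - S y * sin (y $ i)
        = (S x - S y) * sin (x $ i) + S y * (sin (x $ i) - sin (y $ i))"
      by (simp add: algebra_simps)
    then have "\<bar>S x * sin (x $ i) - S y * sin (y $ i)\<bar>
        \<le> \<bar>S x - S y\<bar> * \<bar>sin (x $ i)\<bar> + \<bar>S y\<bar> * \<bar>sin (x $ i) - sin (y $ i)\<bar>"
      by (metis abs_mult abs_triangle_ineq)
    also have "\<dots> \<le> (?N * norm (x - y)) * 1 + (2 * ?N) * norm (x - y)"
      by (intro add_mono mult_mono S_diff S_le order_trans[OF abs_sin_diff_le comp]) auto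
    finally have "\<bar>S x * sin (x $ i) - S y * sin (y $ i)\<bar> \<le> 3 * ?N * norm (x - y)" by simp
    then have "\<kappa> / ?N * \<bar>S x * sin (x $ i) - S y * sin (y $ i)\<bar> \<le> \<kappa> / ?N * (3 * ?N * norm (x - y))"
      using assms by (intro mult_left_mono) auto
    moreover have "(kura_rhs \<kappa> \<omega> x - kura_rhs \<kappa> \<omega> y) $ i
        = - (\<kappa> / ?N * (S x * sin (x $ i) - S y * sin (y $ i)))"
      by (simp add: kura_rhs_def S_def right_diff_distrib)
    ultimately show ?thesis using assms by (simp add: abs_mult)
  qed
  have "norm (kura_rhs \<kappa> \<omega> x - kura_rhs \<kappa> \<omega> y)
      \<le> (\<Sum>i\<in>UNIV. \<bar>(kura_rhs \<kappa> \<omega> x - kura_rhs \<kappa> \<omega> y) $ i\<bar>)"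
    by (rule norm_le_l1_cart)
  also have "\<dots> \<le> (\<Sum>i\<in>(UNIV::'n set). 3 * \<kappa> * norm (x - y))"
    by (intro sum_mono each)
  finally show ?thesis by (simp add: mult_ac)
qed

section \<open>Uniqueness and measurable sets of initial data\<close>

lemma is_solution_unique:
  assumes "\<kappa> > 0" "is_solution \<kappa> \<omega> x \<theta>" "is_solution \<kappa> \<omega> x \<eta>" "t \<ge> 0"
  shows "\<theta> t = \<eta> t"
  using norm_diff_solutions_le[OF kura_rhs_lipschitz[OF assms(1)], of \<theta> \<omega> \<eta> t] assms
  by (auto simp: is_solution_def)

text \<open>Solutions from convergent initial data converge pointwise to a solution from the limit
  point, and \<open>P\<close> survives such limits.\<close>

lemma closed_initial_data:
  fixes \<omega> :: "real^'n"
  assumes "\<kappa> > 0"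
    and lim: "\<And>\<Theta> \<theta>. (\<And>n::nat. P (\<Theta> n)) \<Longrightarrow> (\<And>t. t \<ge> 0 \<Longrightarrow> (\<lambda>n. \<Theta> n t) \<longlonglongrightarrow> \<theta> t) \<Longrightarrow> P \<theta>"
  shows "closed {x. \<exists>\<theta>. is_solution \<kappa> \<omega> x \<theta> \<and> P \<theta>}"
  unfolding closed_sequential_limits
proof (intro allI impI, elim conjE)
  fix X x assume X: "\<forall>n. X n \<in> {x. \<exists>\<theta>. is_solution \<kappa> \<omega> x \<theta> \<and> P \<theta>}" and "X \<longlonglongrightarrow> x"
  then obtain \<Theta> where \<Theta>: "\<And>n. is_solution \<kappa> \<omega> (X n) (\<Theta> n)" "\<And>n. P (\<Theta> n)"
    by simp metis
  then have "(\<lambda>n. \<Theta> n 0) \<longlonglongrightarrow> x"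
    using \<open>X \<longlonglongrightarrow> x\<close> by (simp add: is_solution_def)
  moreover have "(\<Theta> n has_vector_derivative kura_rhs \<kappa> \<omega> (\<Theta> n t)) (at t within {0..})" if "t \<ge> 0" for n t
    using \<Theta>(1) that by (simp add: is_solution_def)
  ultimately obtain \<theta> where \<theta>: "\<And>t. t \<ge> 0 \<Longrightarrow> (\<lambda>n. \<Theta> n t) \<longlonglongrightarrow> \<theta> t"
      "\<And>t. t \<ge> 0 \<Longrightarrow> (\<theta> has_vector_derivative kura_rhs \<kappa> \<omega> (\<theta> t)) (at t within {0..})"
    using limit_of_solutions[of "kura_rhs \<kappa> \<omega>" "3 * \<kappa> * real CARD('n)" \<Theta> x]
      kura_rhs_lipschitz[OF assms(1), of \<omega>] assms(1) by (auto simp: mult_nonneg_nonneg)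
  have "\<theta> 0 = x"
    using LIMSEQ_unique[OF \<theta>(1)[of 0] \<open>(\<lambda>n. \<Theta> n 0) \<longlonglongrightarrow> x\<close>] by simp
  then have "is_solution \<kappa> \<omega> x \<theta>" using \<theta>(2) by (simp add: is_solution_def)
  moreover have "P \<theta>" using lim \<Theta>(2) \<theta>(1) by blast
  ultimately show "x \<in> {x. \<exists>\<theta>. is_solution \<kappa> \<omega> x \<theta> \<and> P \<theta>}" by blast
qed

lemma cube_eq_cbox: "cube = cbox (\<chi> i. - pi) (\<chi> i. pi)"
  by (auto simp: cube_def mem_box_cart)

text \<open>No existence theorem is needed: the initial data without a solution form an open set
  and satisfy the condition vacuously.\<close>

lemma initial_data_in_borel:
  fixes \<omega> :: "real^'n"
  assumes "\<kappa> > 0"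
    and lim: "\<And>\<Theta> \<theta>. (\<And>n::nat. P (\<Theta> n)) \<Longrightarrow> (\<And>t. t \<ge> 0 \<Longrightarrow> (\<lambda>n. \<Theta> n t) \<longlonglongrightarrow> \<theta> t) \<Longrightarrow> P \<theta>"
  shows "{x \<in> cube. \<forall>\<theta>. is_solution \<kappa> \<omega> x \<theta> \<longrightarrow> P \<theta>} \<in> sets borel"
proof -
  \<comment> \<open>Constant sequences in \<open>lim\<close> show that \<open>P\<close> depends only
    on times \<open>t \<ge> 0\<close>, where solutions are unique. Hence "every solution" and "some
    solution" agree whenever a solution exists.\<close>
  have "P \<eta>" if "is_solution \<kappa> \<omega> x \<theta>" "P \<theta>" "is_solution \<kappa> \<omega> x \<eta>" for x \<theta> \<eta>
    using lim[of "\<lambda>_. \<theta>" \<eta>] is_solution_unique[OF assms(1) that(1,3)] that(2) by simp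
  then have "{x \<in> cube. \<forall>\<theta>. is_solution \<kappa> \<omega> x \<theta> \<longrightarrow> P \<theta>} =
      cube \<inter> (- {x. \<exists>\<theta>. is_solution \<kappa> \<omega> x \<theta> \<and> True} \<union> {x. \<exists>\<theta>. is_solution \<kappa> \<omega> x \<theta> \<and> P \<theta>})"
    by blast
  also have "\<dots> \<in> sets borel"
    using closed_initial_data[OF assms(1), of "\<lambda>_. True" \<omega>] closed_initial_data[OF assms(1), of P \<omega>] lim
    by (intro sets.Int sets.Un borel_comp borel_closed) (auto simp: cube_eq_cbox)
  finally show ?thesis .
qed

text \<open>The strict inequality becomes a countable union of weak inequalities between values at
  two times, each of which passes to pointwise limits.\<close>

lemma osc_bounded_iff:
  "osc_bounded \<theta> i \<longleftrightarrow>
    (\<exists>n::nat. \<forall>s\<ge>0. \<forall>t\<ge>0. \<theta> s $ i - \<theta> t $ i \<le> 2 * pi - 1 / real (Suc n))"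
proof
  let ?S = "SUP t\<in>{0..}. \<theta> t $ i" and ?I = "INF t\<in>{0..}. \<theta> t $ i"
  assume osc: "osc_bounded \<theta> i"
  then have "2 * pi - (?S - ?I) > 0" by (simp add: osc_bounded_def)
  then obtain n where n: "1 / real (Suc n) < 2 * pi - (?S - ?I)"
    using nat_approx_posE by blast
  have "\<theta> s $ i - \<theta> t $ i \<le> 2 * pi - 1 / real (Suc n)" if "s \<ge> 0" "t \<ge> 0" for s t
  proof -
    have "\<theta> s $ i \<le> ?S" using osc that by (intro cSUP_upper) (auto simp: osc_bounded_def)
    moreover have "?I \<le> \<theta> t $ i" using osc that by (intro cINF_lower) (auto simp: osc_bounded_def)
    ultimately show ?thesis using n by linarith
  qed
  then show "\<exists>n::nat. \<forall>s\<ge>0. \<forall>t\<ge>0. \<theta> s $ i - \<theta> t $ i \<le> 2 * pi - 1 / real (Suc n)" by blast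
next
  let ?S = "SUP t\<in>{0..}. \<theta> t $ i" and ?I = "INF t\<in>{0..}. \<theta> t $ i"
  assume "\<exists>n::nat. \<forall>s\<ge>0. \<forall>t\<ge>0. \<theta> s $ i - \<theta> t $ i \<le> 2 * pi - 1 / real (Suc n)"
  then obtain n :: nat where n: "\<And>s t. s \<ge> 0 \<Longrightarrow> t \<ge> 0 \<Longrightarrow> \<theta> s $ i - \<theta> t $ i \<le> 2 * pi - 1 / real (Suc n)"
    by blast
  define M where "M = 2 * pi - 1 / real (Suc n)"
  have M: "\<theta> s $ i - \<theta> t $ i \<le> M" if "s \<ge> 0" "t \<ge> 0" for s t
    using n that by (simp add: M_def)
  have bdd: "bdd_above ((\<lambda>t. \<theta> t $ i) ` {0..})" "bdd_below ((\<lambda>t. \<theta> t $ i) ` {0..})"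
    using M[of _ 0] M[of 0 _]
    by (auto intro!: bdd_aboveI[where M = "M + \<theta> 0 $ i"] bdd_belowI[where m = "\<theta> 0 $ i - M"] simp: algebra_simps)
  have "?S \<le> M + \<theta> t $ i" if "t \<ge> 0" for t
    using M[OF _ that] by (intro cSUP_least) (auto simp: algebra_simps)
  then have "?S - M \<le> ?I"
    by (intro cINF_greatest) (auto simp: algebra_simps)
  moreover have "M < 2 * pi" by (simp add: M_def)
  ultimately show "osc_bounded \<theta> i"
    using bdd by (simp add: osc_bounded_def)
qed

lemma osc_boundedI:
  assumes "M < 2 * pi" "\<And>s t. s \<ge> 0 \<Longrightarrow> t \<ge> 0 \<Longrightarrow> \<theta> s $ i - \<theta> t $ i \<le> M"
  shows "osc_bounded \<theta> i"
proof -
  obtain n where "1 / real (Suc n) < 2 * pi - M"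
    using nat_approx_posE[of "2 * pi - M"] assms(1) by auto
  then show ?thesis
    unfolding osc_bounded_iff using assms(2) by (intro exI[of _ n]) (smt (verit))
qed

lemma osc_bounded_initial_data_in_borel:
  fixes \<omega> :: "real^'n"
  assumes "\<kappa> > 0"
  shows "{x \<in> cube. \<forall>\<theta>. is_solution \<kappa> \<omega> x \<theta> \<longrightarrow> (\<forall>i. osc_bounded \<theta> i)} \<in> sets borel"
proof -
  define Q :: "'n \<Rightarrow> nat \<Rightarrow> (real \<Rightarrow> real^'n) \<Rightarrow> bool"
    where "Q = (\<lambda>i n \<theta>. \<forall>s\<ge>0. \<forall>t\<ge>0. \<theta> s $ i - \<theta> t $ i \<le> 2 * pi - 1 / real (Suc n))"
  have "{x \<in> cube. \<forall>\<theta>. is_solution \<kappa> \<omega> x \<theta> \<longrightarrow> Q i n \<theta>} \<in> sets borel" for i n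
  proof (rule initial_data_in_borel[OF assms])
    fix \<Theta> \<theta> assume Q: "\<And>m::nat. Q i n (\<Theta> m)" and lim: "\<And>t. t \<ge> 0 \<Longrightarrow> (\<lambda>m. \<Theta> m t) \<longlonglongrightarrow> \<theta> t"
    have "\<theta> s $ i - \<theta> t $ i \<le> 2 * pi - 1 / real (Suc n)" if "s \<ge> 0" "t \<ge> 0" for s t
    proof (rule LIMSEQ_le_const2)
      show "(\<lambda>m. \<Theta> m s $ i - \<Theta> m t $ i) \<longlonglongrightarrow> \<theta> s $ i - \<theta> t $ i"
        by (intro tendsto_intros lim that)
      show "\<exists>N. \<forall>m\<ge>N. \<Theta> m s $ i - \<Theta> m t $ i \<le> 2 * pi - 1 / real (Suc n)"
        using Q that unfolding Q_def by blast
    qed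
    then show "Q i n \<theta>" unfolding Q_def by blast
  qed
  then have meas: "cube \<inter> (\<Inter>i. \<Union>n. {x \<in> cube. \<forall>\<theta>. is_solution \<kappa> \<omega> x \<theta> \<longrightarrow> Q i n \<theta>}) \<in> sets borel"
    by (intro sets.Int sets.finite_INT sets.countable_UN) (auto simp: cube_eq_cbox)
  have osc: "osc_bounded \<theta> i \<longleftrightarrow> (\<exists>n. Q i n \<theta>)" for \<theta> i
    by (simp only: osc_bounded_iff Q_def)
  \<comment> \<open>Uniqueness lets one \<open>n\<close> serve all solutions from \<open>x\<close>,
    so the quantifiers over \<open>\<theta>\<close> and \<open>n\<close> can be exchanged.\<close>
  have same: "Q i n \<eta>" if "is_solution \<kappa> \<omega> x \<theta>" "Q i n \<theta>" "is_solution \<kappa> \<omega> x \<eta>" for x \<theta> \<eta> i n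
    using is_solution_unique[OF assms that(1,3)] that(2) by (simp add: Q_def)
  have "(\<forall>\<theta>. is_solution \<kappa> \<omega> x \<theta> \<longrightarrow> (\<forall>i. osc_bounded \<theta> i)) \<longleftrightarrow>
      (\<forall>i. \<exists>n. \<forall>\<theta>. is_solution \<kappa> \<omega> x \<theta> \<longrightarrow> Q i n \<theta>)" for x
    using same osc by metis
  then have "{x \<in> cube. \<forall>\<theta>. is_solution \<kappa> \<omega> x \<theta> \<longrightarrow> (\<forall>i. osc_bounded \<theta> i)} =
      cube \<inter> (\<Inter>i. \<Union>n. {x \<in> cube. \<forall>\<theta>. is_solution \<kappa> \<omega> x \<theta> \<longrightarrow> Q i n \<theta>})"
    by auto
  with meas show ?thesis by simp
qed

subsection \<open>Persistence of the order parameter\<close>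

lemma abs_le_Omega_inf: "\<bar>\<omega> $ i\<bar> \<le> Omega_inf \<omega>"
  unfolding Omega_inf_def by (rule Max_ge) auto

lemma solution_component_derivative:
  fixes \<theta> :: "real \<Rightarrow> real^'n"
  assumes "is_solution \<kappa> \<omega> x \<theta>" "t \<ge> 0"
  shows "((\<lambda>t. \<theta> t $ i) has_real_derivative \<omega> $ i - \<kappa> * order_R \<theta> t * sin (\<theta> t $ i)) (at t within {0..})"
proof -
  have "(\<theta> has_vector_derivative kura_rhs \<kappa> \<omega> (\<theta> t)) (at t within {0..})"
    using assms by (simp add: is_solution_def)
  then have "((\<lambda>t. \<theta> t $ i) has_vector_derivative kura_rhs \<kappa> \<omega> (\<theta> t) $ i) (at t within {0..})"
    by (rule bounded_linear.has_vector_derivative[OF bounded_linear_vec_nth])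
  then show ?thesis
    by (simp add: has_real_derivative_iff_has_vector_derivative kura_rhs_def order_R_def)
qed

lemma order_R_continuous:
  assumes "is_solution \<kappa> \<omega> x \<theta>"
  shows "continuous_on {0..} (order_R \<theta>)"
proof -
  have "continuous_on {0..} (\<lambda>t. \<theta> t $ i)" for i
    by (rule DERIV_continuous_on) (use solution_component_derivative[OF assms] in auto)
  then show ?thesis
    unfolding order_R_def[abs_def]
    by (intro continuous_on_mult_left continuous_on_sum continuous_on_add continuous_on_const continuous_on_cos)
qed

lemma solution_driven_phase:
  assumes "is_solution \<kappa> \<omega> x \<theta>" "\<kappa> > 0" "0 < \<alpha>" "\<alpha> < pi/2" "Omega_inf \<omega> < \<kappa> * r * sin \<alpha>"
    and "is_interval J" "J \<subseteq> {0..}" "\<And>t. t \<in> J \<Longrightarrow> r \<le> order_R \<theta> t"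
  shows "driven_phase J (\<lambda>t. \<theta> t $ i) (\<lambda>t. \<kappa> * order_R \<theta> t) (\<omega> $ i) (\<kappa> * r) \<alpha>"
proof
  fix t assume "t \<in> J"
  then show "((\<lambda>t. \<theta> t $ i) has_real_derivative \<omega> $ i - \<kappa> * order_R \<theta> t * sin (\<theta> t $ i)) (at t within J)"
    using assms(7) by (intro DERIV_subset[OF solution_component_derivative[OF assms(1)]]) auto
  show "\<kappa> * r \<le> \<kappa> * order_R \<theta> t"
    using assms(2,8) \<open>t \<in> J\<close> by (intro mult_left_mono) auto
qed (use assms abs_le_Omega_inf[of \<omega> i] in auto)

text \<open>The amount of \<open>1 + cos\<close> that an oscillator starting at \<open>x\<close> is guaranteed to keep as long
  as the coupling dominates the natural frequencies outside the \<open>\<alpha>\<close>-neighbourhoods of \<open>0\<close> and \<open>pi\<close>.\<close>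

definition kept :: "real \<Rightarrow> real \<Rightarrow> real" where
  "kept \<alpha> x = (if \<bar>x\<bar> \<le> pi - \<alpha> then 1 + min (cos x) (cos \<alpha>) else 0)"

lemma kept_le: "kept \<alpha> x \<le> 1 + cos x"
  unfolding kept_def using cos_ge_minus_one[of x] by (smt (verit))

text \<open>By \<open>abs_le_max\<close> and monotonicity of \<open>cos\<close> on
  \<open>{0..pi}\<close>; a phase with \<open>\<bar>y s\<bar> > pi - \<alpha>\<close> is credited
  only with the trivial bound \<open>0\<close>.\<close>

lemma (in driven_phase) kept_le_cos:
  assumes "s \<in> J" "t \<in> J" "s \<le> t"
  shows "kept \<alpha> (y s) \<le> 1 + cos (y t)"
proof (cases "\<bar>y s\<bar> \<le> pi - \<alpha>")
  case True
  have "cos (max \<bar>y s\<bar> \<alpha>) \<le> cos \<bar>y t\<bar>"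
    using abs_le_max[OF assms True] True alpha by (intro cos_monotone_0_pi_le) auto
  moreover have "min (cos (y s)) (cos \<alpha>) \<le> cos (max \<bar>y s\<bar> \<alpha>)"
    by (auto simp: max_def)
  ultimately show ?thesis using True by (simp add: kept_def)
next
  case False
  then show ?thesis using cos_ge_minus_one[of "y t"] unfolding kept_def by (smt (verit))
qed

text \<open>The barriers presuppose the bound on the order parameter that they are meant to prove.
  The continuity argument breaks the circle: while \<open>r \<le> order_R\<close> on
  \<open>{0..T}\<close>, every oscillator retains its \<open>kept\<close> amount, and the average of
  these exceeds \<open>r\<close>.\<close>

lemma order_R_stays_large:
  fixes \<theta> :: "real \<Rightarrow> real^'n"
  assumes sol: "is_solution \<kappa> \<omega> x \<theta>" and "\<kappa> > 0" "0 < \<alpha>" "\<alpha> < pi/2"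
    and strong: "Omega_inf \<omega> < \<kappa> * r * sin \<alpha>"
    and start: "real CARD('n) * r < (\<Sum>i\<in>UNIV. kept \<alpha> (x $ i))"
    and "t \<ge> 0"
  shows "r < order_R \<theta> t"
proof -
  have x: "\<theta> 0 = x" using sol by (simp add: is_solution_def)
  have large: "r < order_R \<theta> T" if "\<And>i. kept \<alpha> (x $ i) \<le> 1 + cos (\<theta> T $ i)" for T
  proof -
    have "real CARD('n) * r < (\<Sum>i\<in>UNIV. 1 + cos (\<theta> T $ i))"
      by (rule less_le_trans[OF start sum_mono]) (rule that)
    then show ?thesis by (simp add: order_R_def field_simps)
  qed
  show ?thesis
  proof (rule bootstrap_lower_bound[OF order_R_continuous[OF sol] _ _ \<open>t \<ge> 0\<close>])
    show "r < order_R \<theta> 0" by (rule large) (simp add: x kept_le)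
    fix T :: real assume T: "T \<ge> 0" "\<And>t. t \<in> {0..T} \<Longrightarrow> r \<le> order_R \<theta> t"
    show "r < order_R \<theta> T"
    proof (rule large)
      fix i
      interpret driven_phase "{0..T}" "\<lambda>t. \<theta> t $ i" "\<lambda>t. \<kappa> * order_R \<theta> t" "\<omega> $ i" "\<kappa> * r" \<alpha>
        by (rule solution_driven_phase) (use assms T in auto)
      show "kept \<alpha> (x $ i) \<le> 1 + cos (\<theta> T $ i)"
        using kept_le_cos[of 0 T] T by (simp add: x)
    qed
  qed
qed

lemma osc_bounded_if_order_R_large:
  assumes sol: "is_solution \<kappa> \<omega> x \<theta>" and "x \<in> cube" "\<kappa> > 0" "0 < \<alpha>" "\<alpha> < pi/2"
    and strong: "Omega_inf \<omega> < \<kappa> * r * sin \<alpha>" and large: "\<And>t. t \<ge> 0 \<Longrightarrow> r \<le> order_R \<theta> t"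
  shows "osc_bounded \<theta> i"
proof -
  interpret driven_phase "{0..}" "\<lambda>t. \<theta> t $ i" "\<lambda>t. \<kappa> * order_R \<theta> t" "\<omega> $ i" "\<kappa> * r" \<alpha>
    by (rule solution_driven_phase) (use assms in auto)
  have "\<bar>\<theta> 0 $ i\<bar> \<le> pi"
    using assms(1,2) by (auto simp: is_solution_def cube_def abs_le_iff minus_le_iff)
  then show ?thesis
    using oscillation_le[of 0] assms(4,5)
    by (intro osc_boundedI[where M = "max (2 * pi - 2 * \<alpha>) (pi + 2 * \<alpha>)"]) auto
qed

section \<open>Numerical margin at \<open>\<alpha> = pi/4\<close> and trapping of the
  cosines\<close>

lemma inverse_2_plus_le: "0 \<le> \<epsilon> \<Longrightarrow> \<epsilon> \<le> 1 \<Longrightarrow> 1 / (2 + \<epsilon>) \<le> 1/2 - \<epsilon>/6" for \<epsilon> :: real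
  using mult_right_mono[of \<epsilon> 1 \<epsilon>] by (simp add: field_simps)

lemma sqrt2_bounds: "1.41421 < sqrt 2" "sqrt 2 < 1.41422"
  by (rule real_less_rsqrt real_less_lsqrt; simp add: power2_eq_square)+

text \<open>Turns the hypothesis on \<open>\<kappa>\<close> into
  \<open>Omega_inf \<omega> < \<kappa> * r * sin \<alpha>\<close>. The product with
  \<open>sin (pi/4)\<close> is \<open>1/2\<close> minus about \<open>0.106 * \<epsilon>\<close>,
  which lies above the chord \<open>1/2 - \<epsilon>/6\<close> of the convex function
  \<open>1 / (2 + \<epsilon>)\<close>.\<close>

lemma threshold_margin:
  fixes \<kappa> \<epsilon> :: real
  assumes "0 < \<kappa>" "0 < \<epsilon>" "\<epsilon> \<le> 1"
  shows "\<kappa> / (2 + \<epsilon>) \<le> \<kappa> * (1 / sqrt 2 - 3 * \<epsilon> / 20) * sin (pi/4)"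
proof -
  have "(1 / sqrt 2 - 3 * \<epsilon> / 20) * sin (pi/4) = 1/2 - 3 * sqrt 2 * \<epsilon> / 40"
    by (simp add: sin_45 field_simps)
  moreover have "3 * sqrt 2 * \<epsilon> / 40 \<le> \<epsilon> / 6"
    using sqrt2_bounds(2) assms by (simp add: field_simps)
  ultimately have "1 / (2 + \<epsilon>) \<le> (1 / sqrt 2 - 3 * \<epsilon> / 20) * sin (pi/4)"
    using inverse_2_plus_le[of \<epsilon>] assms by linarith
  from mult_left_mono[OF this, of \<kappa>] show ?thesis using assms by (simp add: mult.assoc)
qed

lemma inverse_sqrt2: "1 / sqrt 2 = cos (pi/4)" "- 1 / sqrt 2 = cos (pi - pi/4)"
proof -
  show "1 / sqrt 2 = cos (pi/4)" by (simp add: cos_45 field_simps)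
  then show "- 1 / sqrt 2 = cos (pi - pi/4)" unfolding cos_pi_minus by simp
qed

lemma cos_ge_iff_abs_le:
  fixes z \<beta> :: real
  assumes "\<bar>z\<bar> \<le> pi" "0 \<le> \<beta>" "\<beta> \<le> pi"
  shows "cos \<beta> \<le> cos z \<longleftrightarrow> \<bar>z\<bar> \<le> \<beta>"
  using cos_mono_le_eq[of \<beta> "\<bar>z\<bar>"] assms by simp

lemma shift_into_period:
  fixes z :: real
  obtains k :: int where "\<bar>z + 2 * pi * of_int k\<bar> \<le> pi"
proof -
  define k where "k = - \<lfloor>(z + pi) / (2 * pi)\<rfloor>"
  have "of_int (- k) \<le> (z + pi) / (2 * pi)" "(z + pi) / (2 * pi) < of_int (- k) + 1"
    by (simp_all add: k_def)
  then have "\<bar>z + 2 * pi * of_int k\<bar> \<le> pi"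
    by (simp add: field_simps abs_le_iff)
  then show ?thesis using that by blast
qed

text \<open>At \<open>t0\<close> the phase may have left \<open>{-pi..pi}\<close>. After a shift by
  a multiple of \<open>2 * pi\<close> the conditions on the cosine become bounds on the absolute
  value, to which the barriers apply.\<close>

lemma cos_trapping:
  assumes sol: "is_solution \<kappa> \<omega> x \<theta>" and "\<kappa> > 0" "0 < \<alpha>" "\<alpha> < pi/2"
    and strong: "Omega_inf \<omega> < \<kappa> * r * sin \<alpha>" and large: "\<And>t. t \<ge> 0 \<Longrightarrow> r \<le> order_R \<theta> t"
    and "t0 \<ge> 0" "cos (pi - \<alpha>) \<le> cos (\<theta> t0 $ i)" "t \<ge> t0"
  shows "cos (pi - \<alpha>) \<le> cos (\<theta> t $ i)"
    and "pi - 2 * \<alpha> \<le> (\<kappa> * r * sin \<alpha> - Omega_inf \<omega>) * (t - t0) \<Longrightarrow> cos \<alpha> \<le> cos (\<theta> t $ i)"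
proof -
  interpret driven_phase "{0..}" "\<lambda>t. \<theta> t $ i" "\<lambda>t. \<kappa> * order_R \<theta> t" "\<omega> $ i" "\<kappa> * r" \<alpha>
    by (rule solution_driven_phase) (use assms in auto)
  obtain k :: int where k: "\<bar>\<theta> t0 $ i + 2 * pi * of_int k\<bar> \<le> pi" using shift_into_period .
  define z where "z = (\<lambda>t. \<theta> t $ i + 2 * pi * of_int k)"
  interpret z: driven_phase "{0..}" z "\<lambda>t. \<kappa> * order_R \<theta> t" "\<omega> $ i" "\<kappa> * r" \<alpha>
    unfolding z_def by (rule shifted)
  have cos_z: "cos (z s) = cos (\<theta> s $ i)" for s
    by (simp add: z_def cos_add sin_int_2pin cos_int_2pin)
  have z0: "\<bar>z t0\<bar> \<le> pi - \<alpha>"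
    using cos_ge_iff_abs_le[of "z t0" "pi - \<alpha>"] k assms cos_z[of t0] by (simp add: z_def)
  then have zt: "\<bar>z t\<bar> \<le> pi - \<alpha>"
    using z.abs_le_max[of t0 t] assms by auto
  then show "cos (pi - \<alpha>) \<le> cos (\<theta> t $ i)"
    using cos_ge_iff_abs_le[of "z t" "pi - \<alpha>"] assms cos_z[of t] by simp
  assume "pi - 2 * \<alpha> \<le> (\<kappa> * r * sin \<alpha> - Omega_inf \<omega>) * (t - t0)"
  also have "\<dots> \<le> (\<kappa> * r * sin \<alpha> - \<bar>\<omega> $ i\<bar>) * (t - t0)"
    using assms abs_le_Omega_inf[of \<omega> i] by (intro mult_right_mono) auto
  finally have "\<bar>z t\<bar> \<le> \<alpha>" using z.abs_le_alpha_after[of t0 t] z0 assms by simp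
  then show "cos \<alpha> \<le> cos (\<theta> t $ i)"
    using cos_ge_iff_abs_le[of "z t" \<alpha>] assms cos_z[of t] by simp
qed

text \<open>Conditions (ii) and (iii) of the theorem follow from (i), so it suffices to control \<open>order_R\<close>.\<close>

lemma conditions_from_order_R:
  assumes sol: "is_solution \<kappa> \<omega> x \<theta>" and "x \<in> cube" "\<kappa> > 0" and eps: "0 < \<epsilon>" "\<epsilon> \<le> 1"
    and kappa: "\<kappa> > (2 + \<epsilon>) * Omega_inf \<omega>"
    and large: "\<forall>t\<ge>0. order_R \<theta> t \<ge> 1 / sqrt 2 - 3 * \<epsilon> / 20"
  shows "(\<forall>i. osc_bounded \<theta> i)
      \<and> (\<forall>i. \<forall>t0\<ge>0. cos (\<theta> t0 $ i) \<ge> - 1 / sqrt 2 \<longrightarrow>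
            (\<forall>t\<ge>t0. cos (\<theta> t $ i) \<ge> - 1 / sqrt 2) \<and>
            (\<forall>t\<ge>t0 + (2 + \<epsilon>) * pi / (\<kappa> - (2 + \<epsilon>) * Omega_inf \<omega>). cos (\<theta> t $ i) \<ge> 1 / sqrt 2))"
proof -
  define r where "r = 1 / sqrt 2 - 3 * \<epsilon> / 20"
  have margin: "\<kappa> / (2 + \<epsilon>) \<le> \<kappa> * r * sin (pi/4)"
    unfolding r_def by (intro threshold_margin assms)
  have gap: "Omega_inf \<omega> < \<kappa> / (2 + \<epsilon>)" using kappa eps by (simp add: field_simps)
  then have strong: "Omega_inf \<omega> < \<kappa> * r * sin (pi/4)" using margin by simp
  have alpha: "0 < pi/4" "pi/4 < pi/2" by auto
  have large_r: "r \<le> order_R \<theta> t" if "t \<ge> 0" for t using large that by (simp add: r_def)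
  note trap = cos_trapping[OF sol \<open>\<kappa> > 0\<close> alpha strong large_r, folded inverse_sqrt2]
  have "cos (\<theta> t $ i) \<ge> 1 / sqrt 2"
    if "t0 \<ge> 0" "cos (\<theta> t0 $ i) \<ge> - 1 / sqrt 2"
      and t: "t \<ge> t0 + (2 + \<epsilon>) * pi / (\<kappa> - (2 + \<epsilon>) * Omega_inf \<omega>)" for i t0 t
  proof -
    define D where "D = \<kappa> - (2 + \<epsilon>) * Omega_inf \<omega>"
    have D: "D > 0" using kappa by (simp add: D_def)
    have "0 \<le> (2 + \<epsilon>) * pi / D" using D eps by simp
    then have t0: "t0 \<le> t" using t by (simp add: D_def)
    \<comment> \<open>The uniform speed is at least \<open>D / (2 + \<epsilon>)\<close> and the
      distance to cover is \<open>pi/2\<close>, so the prescribed waiting time is twice what is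
      needed.\<close>
    have "pi - 2 * (pi/4) \<le> (D / (2 + \<epsilon>)) * ((2 + \<epsilon>) * pi / D)"
      using D eps by simp
    also have "\<dots> \<le> (D / (2 + \<epsilon>)) * (t - t0)"
      using t D eps by (intro mult_left_mono) (auto simp: D_def)
    also have "\<dots> \<le> (\<kappa> * r * sin (pi/4) - Omega_inf \<omega>) * (t - t0)"
      using margin t0 eps by (intro mult_right_mono) (auto simp: D_def diff_divide_distrib)
    finally show ?thesis by (intro trap(2)[OF _ that(1,2) t0]) auto
  qed
  then show ?thesis
    using osc_bounded_if_order_R_large[OF sol assms(2) \<open>\<kappa> > 0\<close> alpha strong large_r] trap(1)
    by blast
qed

subsection \<open>Chernoff bounds on the cube\<close>

text \<open>Independence of the coordinates, transported from the standard basis to the index type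
  by \<open>axis i 1\<close>.\<close>

lemma nn_integral_lborel_prod_cart:
  fixes f :: "real \<Rightarrow> ennreal"
  assumes [measurable]: "f \<in> borel_measurable borel"
  shows "(\<integral>\<^sup>+x. (\<Prod>i\<in>UNIV. f (x $ i)) \<partial>(lborel :: (real^'n) measure)) = (\<integral>\<^sup>+x. f x \<partial>lborel) ^ CARD('n)"
proof -
  have Basis: "(Basis :: (real^'n) set) = range (\<lambda>i. axis i 1)" by (auto simp: Basis_vec_def)
  have inj: "inj (\<lambda>i::'n. axis i (1::real))" by (auto simp: inj_def axis_eq_axis)
  have "(\<integral>\<^sup>+x. (\<Prod>i\<in>UNIV. f (x $ i)) \<partial>(lborel :: (real^'n) measure))
      = (\<integral>\<^sup>+x. (\<Prod>b\<in>Basis. f (x \<bullet> b)) \<partial>(lborel :: (real^'n) measure))"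
    unfolding Basis by (subst prod.reindex[OF inj]) (simp add: cart_eq_inner_axis)
  also have "\<dots> = (\<Prod>b\<in>(Basis :: (real^'n) set). \<integral>\<^sup>+x. f x \<partial>lborel)"
    by (rule nn_integral_lborel_prod) auto
  finally show ?thesis by simp
qed

lemma cube_in_borel [measurable]: "cube \<in> sets borel"
  by (simp add: cube_eq_cbox)

lemma emeasure_cube: "emeasure lborel (cube :: (real^'n) set) = ennreal ((2 * pi) ^ CARD('n))"
proof -
  have "emeasure lborel (cube :: (real^'n) set) = (\<Prod>b\<in>Basis. ((\<chi> i. pi) - (\<chi> i. - pi) :: real^'n) \<bullet> b)"
    unfolding cube_eq_cbox by (rule emeasure_lborel_cbox) (auto simp: Basis_vec_def inner_axis)
  also have "(\<Prod>b\<in>Basis. ((\<chi> i. pi) - (\<chi> i. - pi) :: real^'n) \<bullet> b) = (\<Prod>b\<in>(Basis :: (real^'n) set). 2 * pi)"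
    by (rule prod.cong) (auto simp: Basis_vec_def inner_axis)
  finally show ?thesis by simp
qed

text \<open>On the event the exponent \<open>l * (CARD('n) * c - \<Sum> f)\<close> is nonnegative,
  so its exponential dominates the indicator and factorizes over the coordinates.\<close>

lemma chernoff_cube:
  fixes f :: "real \<Rightarrow> real"
  assumes [measurable]: "f \<in> borel_measurable borel" and "l \<ge> 0"
    and bound: "(\<integral>\<^sup>+x. ennreal (exp (l * (c - f x))) * indicator {-pi..pi} x \<partial>lborel) \<le> ennreal B" "B \<ge> 0"
  shows "emeasure lborel {x \<in> (cube :: (real^'n) set). (\<Sum>i\<in>UNIV. f (x $ i)) \<le> real CARD('n) * c}
    \<le> ennreal (B ^ CARD('n))"
proof -
  define g where "g = (\<lambda>x. ennreal (exp (l * (c - f x))) * indicator {-pi..pi} x)"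
  have [measurable]: "g \<in> borel_measurable borel" unfolding g_def by measurable
  let ?A = "{x \<in> (cube :: (real^'n) set). (\<Sum>i\<in>UNIV. f (x $ i)) \<le> real CARD('n) * c}"
  have "indicator ?A x \<le> (\<Prod>i\<in>UNIV. g (x $ i))" for x :: "real^'n"
  proof (cases "x \<in> ?A")
    case True
    then have "(\<Prod>i\<in>UNIV. g (x $ i)) = (\<Prod>i\<in>UNIV. ennreal (exp (l * (c - f (x $ i)))))"
      by (intro prod.cong) (auto simp: g_def cube_def)
    also have "\<dots> = ennreal (exp (\<Sum>i\<in>UNIV. l * (c - f (x $ i))))"
      by (simp add: prod_ennreal exp_sum)
    finally have eq: "(\<Prod>i\<in>UNIV. g (x $ i)) = ennreal (exp (\<Sum>i\<in>UNIV. l * (c - f (x $ i))))" .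
    have "(\<Sum>i\<in>UNIV. l * (c - f (x $ i))) = l * (real CARD('n) * c - (\<Sum>i\<in>UNIV. f (x $ i)))"
      by (simp add: sum_distrib_left[symmetric] sum_subtractf)
    also have "\<dots> \<ge> 0" using True \<open>l \<ge> 0\<close> by simp
    finally have "1 \<le> exp (\<Sum>i\<in>UNIV. l * (c - f (x $ i)))" by simp
    then show ?thesis unfolding eq using True by (simp flip: ennreal_1 del: ennreal_1)
  qed simp
  then have "(\<integral>\<^sup>+x. indicator ?A x \<partial>lborel) \<le> (\<integral>\<^sup>+x. (\<Prod>i\<in>UNIV. g (x $ i)) \<partial>(lborel :: (real^'n) measure))"
    by (intro nn_integral_mono) auto
  also have "\<dots> = (\<integral>\<^sup>+x. g x \<partial>lborel) ^ CARD('n)"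
    by (rule nn_integral_lborel_prod_cart) measurable
  also have "\<dots> \<le> ennreal B ^ CARD('n)"
    using bound(1) unfolding g_def by (rule power_mono) simp
  also have "\<dots> = ennreal (B ^ CARD('n))" using bound(2) by (simp add: ennreal_power)
  finally show ?thesis by simp
qed

text \<open>\<open>S\<close> and the Chernoff event cover the cube. The factor \<open>2 * pi\<close>
  in \<open>bound\<close> cancels against the normalization, so \<open>q\<close> bounds the mean
  exponential of one phase.\<close>

lemma norm_meas_ge_chernoff:
  fixes f :: "real \<Rightarrow> real" and S :: "(real^'n) set"
  assumes [measurable]: "f \<in> borel_measurable borel" and "l \<ge> 0"
    and bound: "(\<integral>\<^sup>+x. ennreal (exp (l * (c - f x))) * indicator {-pi..pi} x \<partial>lborel) \<le> ennreal (2 * pi * q)" "q \<ge> 0"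
    and S [measurable]: "S \<in> sets borel" and "S \<subseteq> cube"
    and good: "\<And>x. x \<in> cube \<Longrightarrow> real CARD('n) * c < (\<Sum>i\<in>UNIV. f (x $ i)) \<Longrightarrow> x \<in> S"
  shows "norm_meas S \<ge> 1 - q ^ CARD('n)"
proof -
  let ?N = "CARD('n)"
  let ?A = "{x \<in> (cube :: (real^'n) set). (\<Sum>i\<in>UNIV. f (x $ i)) \<le> real CARD('n) * c}"
  have A: "?A \<in> sets lborel"
  proof -
    have "{x \<in> space lborel. x \<in> (cube :: (real^'n) set) \<and> (\<Sum>i\<in>UNIV. f (x $ i)) \<le> real CARD('n) * c} \<in> sets lborel"
      by measurable
    then show ?thesis by simp
  qed
  have "emeasure lborel S \<le> emeasure lborel (cube :: (real^'n) set)"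
    using \<open>S \<subseteq> cube\<close> by (intro emeasure_mono) auto
  then have fin: "emeasure lborel S < \<infinity>" by (simp add: emeasure_cube top.not_eq_extremum le_less_trans)
  have mS: "measure lebesgue S = measure lborel S" by simp
  have "ennreal ((2 * pi) ^ ?N) = emeasure lborel (cube :: (real^'n) set)" by (simp add: emeasure_cube)
  also have "\<dots> \<le> emeasure lborel (S \<union> ?A)"
    using good A by (intro emeasure_mono) force+
  also have "\<dots> \<le> emeasure lborel S + emeasure lborel ?A"
    using A by (intro emeasure_subadditive) auto
  also have "\<dots> \<le> ennreal (measure lborel S) + ennreal ((2 * pi * q) ^ ?N)"
    using bound fin by (intro add_mono chernoff_cube[OF assms(1,2)])
      (auto simp: emeasure_eq_ennreal_measure top.not_eq_extremum)
  also have "\<dots> = ennreal (measure lborel S + (2 * pi * q) ^ ?N)"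
    using bound(2) by (simp add: ennreal_plus)
  finally have "(2 * pi) ^ ?N \<le> measure lborel S + (2 * pi) ^ ?N * q ^ ?N"
    using bound(2) by (subst (asm) ennreal_le_iff) (auto simp: power_mult_distrib mult_ac)
  then show ?thesis
    unfolding norm_meas_def mS by (simp add: field_simps)
qed

section \<open>Mean and exponential moment of the kept amount\<close>

lemma borel_measurable_kept [measurable]: "kept \<alpha> \<in> borel_measurable borel"
  unfolding kept_def[abs_def] by measurable

text \<open>On \<open>{0..pi}\<close> the function is constant up to \<open>\<alpha>\<close>, then
  \<open>1 + cos x\<close>, then \<open>0\<close> beyond \<open>pi - \<alpha>\<close>; evenness
  doubles the result.\<close>

lemma kept_has_integral:
  assumes "0 < \<alpha>" "\<alpha> < pi/2"
  shows "(kept \<alpha> has_integral 2 * (pi - \<alpha> + \<alpha> * cos \<alpha>)) {-pi..pi}"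
proof -
  have inner: "(kept \<alpha> has_integral \<alpha> * (1 + cos \<alpha>)) {0..\<alpha>}"
  proof (rule has_integral_eq)
    show "((\<lambda>x. 1 + cos \<alpha>) has_integral \<alpha> * (1 + cos \<alpha>)) {0..\<alpha>}"
      using has_integral_const_real[of "1 + cos \<alpha>" 0 \<alpha>] assms by simp
    show "1 + cos \<alpha> = kept \<alpha> x" if "x \<in> {0..\<alpha>}" for x
      using that assms cos_monotone_0_pi_le[of x \<alpha>] by (auto simp: kept_def min_def)
  qed
  have middle: "(kept \<alpha> has_integral pi - 2 * \<alpha>) {\<alpha>..pi - \<alpha>}"
  proof (rule has_integral_eq)
    have "((\<lambda>x. 1 + cos x) has_integral ((pi - \<alpha>) + sin (pi - \<alpha>)) - (\<alpha> + sin \<alpha>)) {\<alpha>..pi - \<alpha>}"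
      using assms by (intro fundamental_theorem_of_calculus)
        (auto intro!: derivative_eq_intros simp flip: has_real_derivative_iff_has_vector_derivative)
    then show "((\<lambda>x. 1 + cos x) has_integral pi - 2 * \<alpha>) {\<alpha>..pi - \<alpha>}" by simp
    show "1 + cos x = kept \<alpha> x" if "x \<in> {\<alpha>..pi - \<alpha>}" for x
      using that assms cos_monotone_0_pi_le[of \<alpha> x] by (auto simp: kept_def min_def)
  qed
  \<comment> \<open>At the single point \<open>pi - \<alpha>\<close> the value is
    \<open>1 - cos \<alpha>\<close> instead of \<open>0\<close>.\<close>
  have outer: "(kept \<alpha> has_integral 0) {pi - \<alpha>..pi}"
    by (rule has_integral_spike_finite[where S = "{pi - \<alpha>}" and f = "\<lambda>_. 0"])
       (use assms in \<open>auto simp: kept_def\<close>)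
  have "(kept \<alpha> has_integral \<alpha> * (1 + cos \<alpha>) + (pi - 2 * \<alpha>)) {0..pi - \<alpha>}"
    by (rule has_integral_combine[OF _ _ inner middle]) (use assms in auto)
  then have "(kept \<alpha> has_integral \<alpha> * (1 + cos \<alpha>) + (pi - 2 * \<alpha>) + 0) {0..pi}"
    by (rule has_integral_combine[rotated 2, OF _ outer]) (use assms in auto)
  then have right: "(kept \<alpha> has_integral pi - \<alpha> + \<alpha> * cos \<alpha>) {0..pi}"
    by (simp add: algebra_simps)
  have "((\<lambda>x. kept \<alpha> (- x)) has_integral pi - \<alpha> + \<alpha> * cos \<alpha>) {-pi..-0}"
    using right by (subst has_integral_reflect_real) auto
  moreover have "(\<lambda>x. kept \<alpha> (- x)) = kept \<alpha>" by (simp add: kept_def fun_eq_iff)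
  ultimately have "(kept \<alpha> has_integral pi - \<alpha> + \<alpha> * cos \<alpha>) {-pi..0}" by simp
  from has_integral_combine[OF _ _ this right] show ?thesis by (simp add: algebra_simps)
qed

lemma exp_minus_le_quadratic:
  fixes x :: real
  assumes "x \<ge> 0"
  shows "exp (- x) \<le> 1 - x + x\<^sup>2 / 2"
proof -
  have "exp (- 0) - (1 - 0 + 0\<^sup>2 / 2) \<ge> exp (- x) - (1 - x + x\<^sup>2 / 2)"
    by (rule DERIV_nonpos_imp_nonincreasing[OF assms])
       (auto intro!: exI derivative_eq_intros, smt (verit) exp_ge_add_one_self)
  then show ?thesis by simp
qed

lemma kept_nonneg: "0 \<le> kept \<alpha> x"
  unfolding kept_def using cos_ge_minus_one[of x] cos_ge_minus_one[of \<alpha>] by (smt (verit))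

lemma kept_upper: "kept \<alpha> x \<le> 1 + cos \<alpha>"
  unfolding kept_def using cos_ge_minus_one[of \<alpha>] by (smt (verit))

text \<open>The constant \<open>1/4\<close> is nearly the optimal Chernoff parameter at \<open>\<epsilon> = 1\<close>, where the estimate
  is tightest.\<close>

lemma kept_chernoff_integral:
  fixes \<epsilon> :: real
  assumes "0 < \<epsilon>" "\<epsilon> \<le> 1"
  shows "(\<integral>\<^sup>+x. ennreal (exp (1/4 * ((1 / sqrt 2 - 3 * \<epsilon> / 20) - kept (pi/4) x))) * indicator {-pi..pi} x \<partial>lborel)
    \<le> ennreal (2 * pi * exp (- (\<epsilon>\<^sup>2 / 25)))"
proof -
  define r where "r = 1 / sqrt 2 - 3 * \<epsilon> / 20"
  \<comment> \<open>\<open>b\<close> is the maximum of \<open>kept (pi/4)\<close> and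
    \<open>\<mu>\<close> its mean over \<open>{-pi..pi}\<close>. Since
    \<open>g * g \<le> b * g\<close> for \<open>0 \<le> g \<le> b\<close>, the quadratic bound on
    \<open>exp (- g/4)\<close> becomes linear with slope \<open>- k\<close>, and only the mean has
    to be integrated.\<close>
  define b where "b = 1 + 1 / sqrt 2"
  define k where "k = 1/4 - b/32"
  define \<mu> where "\<mu> = 3/4 + sqrt 2 / 8"
  have isq: "1 / sqrt 2 = sqrt 2 / 2" by (simp add: field_simps)
  have b: "0 \<le> b" "b \<le> 1.7072" unfolding b_def isq using sqrt2_bounds by auto
  have kept: "0 \<le> kept (pi/4) x" "kept (pi/4) x \<le> b" for x
    using kept_nonneg[of "pi/4" x] kept_upper[of "pi/4" x] by (auto simp: b_def inverse_sqrt2)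
  have pw: "exp (1/4 * (r - kept (pi/4) x)) \<le> exp (r/4) * (1 - k * kept (pi/4) x)" for x
  proof -
    let ?g = "kept (pi/4) x"
    have "exp (- (?g/4)) \<le> 1 - ?g/4 + (?g/4)\<^sup>2 / 2"
      using kept by (intro exp_minus_le_quadratic) auto
    also have "\<dots> \<le> 1 - k * ?g"
      using mult_right_mono[OF kept(2)[of x] kept(1)[of x]]
      by (simp add: k_def power2_eq_square field_simps)
    finally have "exp (r/4) * exp (- (?g/4)) \<le> exp (r/4) * (1 - k * ?g)"
      by (intro mult_left_mono) auto
    then show ?thesis by (simp add: algebra_simps diff_divide_distrib flip: exp_add)
  qed
  have "(kept (pi/4) has_integral 2 * pi * \<mu>) {-pi..pi}"
    using kept_has_integral[of "pi/4"] by (simp add: \<mu>_def cos_45 field_simps)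
  then have int: "((\<lambda>x. exp (r/4) * (1 - k * kept (pi/4) x)) has_integral
      exp (r/4) * (2 * pi - k * (2 * pi * \<mu>))) {-pi..pi}"
    using has_integral_const_real[of "1::real" "-pi" pi]
    by (intro has_integral_mult_right has_integral_diff) auto
  have "(\<integral>\<^sup>+x. ennreal (exp (1/4 * (r - kept (pi/4) x))) * indicator {-pi..pi} x \<partial>lborel)
      \<le> (\<integral>\<^sup>+x. ennreal (exp (r/4) * (1 - k * kept (pi/4) x)) * indicator {-pi..pi} x \<partial>lborel)"
    by (intro nn_integral_mono mult_right_mono ennreal_leI pw) auto
  also have "\<dots> = ennreal (exp (r/4) * (2 * pi - k * (2 * pi * \<mu>)))"
    by (rule nn_integral_has_integral_lebesgue'[OF _ int]) (rule order_trans[OF _ pw], simp)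
  also have "\<dots> \<le> ennreal (2 * pi * exp (- (\<epsilon>\<^sup>2 / 25)))"
  proof (rule ennreal_leI)
    have "exp (r/4) * (2 * pi - k * (2 * pi * \<mu>)) = 2 * pi * (exp (r/4) * (1 - k * \<mu>))"
      by (simp add: algebra_simps)
    also have "\<dots> \<le> 2 * pi * (exp (r/4) * exp (- (k * \<mu>)))"
      using exp_ge_add_one_self[of "- (k * \<mu>)"] by (intro mult_left_mono) auto
    also have "\<dots> = 2 * pi * exp (r/4 - k * \<mu>)" by (simp flip: exp_add)
    \<comment> \<open>The numerical bounds give at most
      \<open>- 0.005 - 0.0375 * \<epsilon>\<close>; as \<open>\<epsilon> \<le> 1\<close>, this is
      below \<open>- 0.04 * \<epsilon>\<close>, hence below
      \<open>- \<epsilon>\<^sup>2 / 25\<close>.\<close>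
    also have "r/4 - k * \<mu> \<le> - (\<epsilon>\<^sup>2 / 25)"
    proof -
      have "0.19665 \<le> k" using b by (simp add: k_def)
      moreover have "0.92677 \<le> \<mu>" unfolding \<mu>_def using sqrt2_bounds by simp
      ultimately have "0.19665 * 0.92677 \<le> k * \<mu>" by (intro mult_mono) auto
      moreover have "r/4 \<le> 0.176778 - 0.0375 * \<epsilon>" unfolding r_def isq using sqrt2_bounds by simp
      moreover have "\<epsilon>\<^sup>2 \<le> \<epsilon>" using assms by (simp add: power2_eq_square mult_left_le_one_le)
      ultimately show ?thesis using assms by simp
    qed
    then have "2 * pi * exp (r/4 - k * \<mu>) \<le> 2 * pi * exp (- (\<epsilon>\<^sup>2 / 25))" by simp
    finally show "exp (r/4) * (2 * pi - k * (2 * pi * \<mu>)) \<le> 2 * pi * exp (- (\<epsilon>\<^sup>2 / 25))" .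
  qed
  finally show ?thesis by (simp add: r_def)
qed

subsection \<open>Spread initial data\<close>

text \<open>Jordan's inequality: the concave sine lies above its chord from \<open>0\<close> to
  \<open>pi/2\<close>.\<close>

lemma sin_half_ge:
  assumes "0 \<le> u" "u \<le> pi"
  shows "u / pi \<le> sin (u / 2)"
proof -
  have "concave_on {0..pi} sin"
    by (rule f''_le0_imp_concave[where f' = cos and f'' = "\<lambda>x. - sin x"])
       (auto intro!: derivative_eq_intros sin_ge_zero)
  from concave_onD[OF this, of "u / pi" 0 "pi/2"] show ?thesis
    using assms by (simp add: field_simps)
qed

text \<open>Half-angle formula and Jordan's inequality. The bound is quadratic in the distance to
  \<open>pi\<close>, which makes the Chernoff integrand Gaussian.\<close>

lemma one_plus_cos_ge:
  assumes "\<bar>x\<bar> \<le> pi"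
  shows "2 * ((pi - \<bar>x\<bar>) / pi)\<^sup>2 \<le> 1 + cos x"
proof -
  have "((pi - \<bar>x\<bar>) / pi)\<^sup>2 \<le> (sin ((pi - \<bar>x\<bar>) / 2))\<^sup>2"
    using assms by (intro power_mono sin_half_ge) auto
  also have "sin ((pi - \<bar>x\<bar>) / 2) = cos (\<bar>x\<bar> / 2)"
    by (simp add: diff_divide_distrib sin_diff)
  also have "2 * (cos (\<bar>x\<bar> / 2))\<^sup>2 = 1 + cos x"
    using cos_double_cos[of "\<bar>x\<bar> / 2"] by simp
  finally show ?thesis by simp
qed

lemma nn_integral_gaussian:
  assumes "\<sigma> > 0"
  shows "(\<integral>\<^sup>+u. ennreal (exp (- u\<^sup>2 / (2 * \<sigma>\<^sup>2))) \<partial>lborel) = ennreal (sqrt (2 * pi) * \<sigma>)"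
proof -
  have "(\<integral>\<^sup>+u. ennreal (exp (- u\<^sup>2 / (2 * \<sigma>\<^sup>2))) \<partial>lborel)
      = (\<integral>\<^sup>+u. ennreal (sqrt (2 * pi) * \<sigma>) * ennreal (normal_density 0 \<sigma> u) \<partial>lborel)"
    using assms by (intro nn_integral_cong)
      (simp add: normal_density_def real_sqrt_mult flip: ennreal_mult)
  also have "\<dots> = ennreal (sqrt (2 * pi) * \<sigma>) * (\<integral>\<^sup>+u. ennreal (normal_density 0 \<sigma> u) \<partial>lborel)"
    by (rule nn_integral_cmult) measurable
  also have "(\<integral>\<^sup>+u. ennreal (normal_density 0 \<sigma> u) \<partial>lborel) = 1"
    using assms by (subst nn_integral_eq_integral) auto
  finally show ?thesis by simp
qed

text \<open>Cut at \<open>0\<close> and translate the halves by \<open>pi\<close> and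
  \<open>- pi\<close>: they become disjoint pieces of one Gaussian centred at
  \<open>0\<close>.\<close>

lemma nn_integral_gaussian_reflected_le:
  assumes "\<sigma> > 0"
  shows "(\<integral>\<^sup>+x. ennreal (exp (- (pi - \<bar>x\<bar>)\<^sup>2 / (2 * \<sigma>\<^sup>2))) * indicator {-pi..pi} x \<partial>lborel)
    \<le> ennreal (sqrt (2 * pi) * \<sigma>)"
proof -
  define G where "G = (\<lambda>u::real. ennreal (exp (- u\<^sup>2 / (2 * \<sigma>\<^sup>2))))"
  have [measurable]: "G \<in> borel_measurable borel" unfolding G_def by measurable
  define H where "H = (\<lambda>A u. G u * indicator A u)"
  have [measurable]: "H {0..} \<in> borel_measurable borel" "H {..<0} \<in> borel_measurable borel"
    unfolding H_def by measurable
  have "(\<integral>\<^sup>+x. ennreal (exp (- (pi - \<bar>x\<bar>)\<^sup>2 / (2 * \<sigma>\<^sup>2))) * indicator {-pi..pi} x \<partial>lborel)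
      \<le> (\<integral>\<^sup>+x. H {0..} (pi + 1 * x) + H {..<0} (- pi + 1 * x) \<partial>lborel)"
  proof (rule nn_integral_mono_AE)
    show "AE x in lborel. ennreal (exp (- (pi - \<bar>x\<bar>)\<^sup>2 / (2 * \<sigma>\<^sup>2))) * indicator {-pi..pi} x
        \<le> H {0..} (pi + 1 * x) + H {..<0} (- pi + 1 * x)"
      \<comment> \<open>The point \<open>pi\<close> is translated to \<open>0\<close>, which
        \<open>{..<0}\<close> misses.\<close>
      using AE_lborel_singleton[of pi]
    proof eventually_elim
      case (elim x)
      show ?case
      proof (cases "x \<in> {-pi..pi}")
        case True
        show ?thesis
        proof (cases "x \<le> 0")
          case x: True
          then have "H {0..} (pi + 1 * x) = ennreal (exp (- (pi - \<bar>x\<bar>)\<^sup>2 / (2 * \<sigma>\<^sup>2)))"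
            using True by (simp add: H_def G_def)
          then show ?thesis using True by simp
        next
          case x: False
          then have "H {..<0} (- pi + 1 * x) = ennreal (exp (- (pi - \<bar>x\<bar>)\<^sup>2 / (2 * \<sigma>\<^sup>2)))"
            using True elim by (simp add: H_def G_def power2_commute)
          then show ?thesis using True by simp
        qed
      qed simp
    qed
  qed
  also have "\<dots> = (\<integral>\<^sup>+x. H {0..} (pi + 1 * x) \<partial>lborel) + (\<integral>\<^sup>+x. H {..<0} (- pi + 1 * x) \<partial>lborel)"
    by (rule nn_integral_add) measurable
  also have "\<dots> = (\<integral>\<^sup>+x. H {0..} x \<partial>lborel) + (\<integral>\<^sup>+x. H {..<0} x \<partial>lborel)"
    using nn_integral_real_affine[of "H {0..}" 1 pi] nn_integral_real_affine[of "H {..<0}" 1 "- pi"]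
    by simp
  also have "\<dots> = (\<integral>\<^sup>+x. H {0..} x + H {..<0} x \<partial>lborel)"
    by (rule nn_integral_add[symmetric]) measurable
  also have "\<dots> = (\<integral>\<^sup>+x. G x \<partial>lborel)"
    by (rule nn_integral_cong) (simp add: H_def indicator_def)
  also have "\<dots> = ennreal (sqrt (2 * pi) * \<sigma>)"
    unfolding G_def by (rule nn_integral_gaussian[OF assms])
  finally show ?thesis .
qed

text \<open>For a parameter \<open>l\<close> the Gaussian bound is
  \<open>exp (2 * l * q\<^sup>2) * pi * sqrt (pi / (2 * l))\<close>, and
  \<open>l = 1 / (4 * q\<^sup>2)\<close> minimizes it.\<close>

lemma cos_chernoff_integral:
  assumes "q > 0"
  shows "(\<integral>\<^sup>+x. ennreal (exp (1 / (4 * q\<^sup>2) * (2 * q\<^sup>2 - (1 + cos x)))) * indicator {-pi..pi} x \<partial>lborel)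
    \<le> ennreal (2 * pi * (sqrt (pi * exp 1 / 2) * q))"
proof -
  define \<sigma> where "\<sigma> = pi * q"
  have "\<sigma> > 0" using assms by (simp add: \<sigma>_def)
  have "exp (1 / (4 * q\<^sup>2) * (2 * q\<^sup>2 - (1 + cos x))) \<le> exp (1/2) * exp (- (pi - \<bar>x\<bar>)\<^sup>2 / (2 * \<sigma>\<^sup>2))"
    if "x \<in> {-pi..pi}" for x
  proof -
    have "1 / (4 * q\<^sup>2) * (2 * q\<^sup>2 - (1 + cos x)) = 1/2 - (1 + cos x) / (4 * q\<^sup>2)"
      using assms by (simp add: field_simps)
    moreover have "(2 * ((pi - \<bar>x\<bar>) / pi)\<^sup>2) / (4 * q\<^sup>2) \<le> (1 + cos x) / (4 * q\<^sup>2)"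
      using that by (intro divide_right_mono one_plus_cos_ge) (auto simp: abs_le_iff)
    moreover have "(2 * ((pi - \<bar>x\<bar>) / pi)\<^sup>2) / (4 * q\<^sup>2) = (pi - \<bar>x\<bar>)\<^sup>2 / (2 * \<sigma>\<^sup>2)"
      using assms by (simp add: \<sigma>_def power_divide power_mult_distrib)
    ultimately show ?thesis by (simp flip: exp_add)
  qed
  then have "(\<integral>\<^sup>+x. ennreal (exp (1 / (4 * q\<^sup>2) * (2 * q\<^sup>2 - (1 + cos x)))) * indicator {-pi..pi} x \<partial>lborel)
      \<le> (\<integral>\<^sup>+x. ennreal (exp (1/2)) * (ennreal (exp (- (pi - \<bar>x\<bar>)\<^sup>2 / (2 * \<sigma>\<^sup>2))) * indicator {-pi..pi} x) \<partial>lborel)"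
    by (intro nn_integral_mono) (auto simp: indicator_def ennreal_mult[symmetric] intro!: ennreal_leI)
  also have "\<dots> = ennreal (exp (1/2)) * (\<integral>\<^sup>+x. ennreal (exp (- (pi - \<bar>x\<bar>)\<^sup>2 / (2 * \<sigma>\<^sup>2))) * indicator {-pi..pi} x \<partial>lborel)"
    by (rule nn_integral_cmult) measurable
  also have "\<dots> \<le> ennreal (exp (1/2)) * ennreal (sqrt (2 * pi) * \<sigma>)"
    by (intro mult_left_mono nn_integral_gaussian_reflected_le[OF \<open>\<sigma> > 0\<close>]) simp
  also have "\<dots> = ennreal (exp (1/2) * (sqrt (2 * pi) * \<sigma>))"
    using \<open>\<sigma> > 0\<close> by (simp flip: ennreal_mult)
  also have "exp (1/2) * (sqrt (2 * pi) * \<sigma>) = 2 * pi * (sqrt (pi * exp 1 / 2) * q)"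
  proof -
    have "exp (1/2) = sqrt (exp (1::real))"
      using exp_double[of "1/2 :: real"] by (simp add: real_sqrt_unique)
    moreover have "sqrt 2 * sqrt 2 = (2::real)" by simp
    ultimately show ?thesis by (simp add: \<sigma>_def real_sqrt_mult real_sqrt_divide field_simps)
  qed
  finally show ?thesis .
qed

text \<open>Capping the cosine at \<open>cos \<alpha>\<close> and discarding phases within
  \<open>\<alpha>\<close> of \<open>pi\<close> or \<open>- pi\<close> each lose at most
  \<open>1 - cos \<alpha>\<close>.\<close>

lemma kept_ge:
  assumes "0 < \<alpha>" "\<alpha> < pi/2" "\<bar>x\<bar> \<le> pi"
  shows "1 + cos x - (1 - cos \<alpha>) \<le> kept \<alpha> x"
proof (cases "\<bar>x\<bar> \<le> pi - \<alpha>")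
  case True
  then show ?thesis using cos_le_one[of x] cos_le_one[of \<alpha>] unfolding kept_def by (smt (verit))
next
  case False
  then have "cos \<bar>x\<bar> \<le> cos (pi - \<alpha>)" using assms by (intro cos_monotone_0_pi_le) auto
  then show ?thesis using False by (simp add: kept_def)
qed

text \<open>With \<open>cos \<alpha> = 1 - q\<^sup>2\<close> the order parameter can lose at most \<open>q\<^sup>2\<close>, and the remaining
  \<open>q\<^sup>2\<close> confines the phases because \<open>sin \<alpha> > q\<close>.\<close>

lemma osc_bounded_if_initially_spread:
  fixes \<theta> :: "real \<Rightarrow> real^'n"
  assumes sol: "is_solution \<kappa> \<omega> x \<theta>" and "x \<in> cube" "\<kappa> > 0"
    and q: "0 < q" "q < 1" "Omega_inf \<omega> \<le> \<kappa> * q ^ 3"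
    and start: "real CARD('n) * (2 * q\<^sup>2) < (\<Sum>i\<in>UNIV. 1 + cos (x $ i))"
  shows "osc_bounded \<theta> i"
proof -
  define \<alpha> where "\<alpha> = arccos (1 - q\<^sup>2)"
  have q2: "0 < q\<^sup>2" "q\<^sup>2 < 1" using q by (auto simp: power_less_one_iff)
  have cos: "cos \<alpha> = 1 - q\<^sup>2" unfolding \<alpha>_def using q2 by (intro cos_arccos) auto
  have a0: "0 < \<alpha>" unfolding \<alpha>_def
    using arccos_less_arccos[of "1 - q\<^sup>2" 1] q2 by simp
  have a1: "\<alpha> < pi/2" unfolding \<alpha>_def
    using arccos_less_arccos[of 0 "1 - q\<^sup>2"] q2 by simp
  have "q < sin \<alpha>"
  proof (rule power_less_imp_less_base)
    \<comment> \<open>Here \<open>1 - (1 - q\<^sup>2)\<^sup>2 = 2 * q\<^sup>2 - q ^ 4\<close>, which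
      exceeds \<open>q\<^sup>2\<close> because \<open>q < 1\<close>.\<close>
    have "q\<^sup>2 * q\<^sup>2 < q\<^sup>2 * 1" using q2 by (intro mult_strict_left_mono) auto
    then show "q\<^sup>2 < (sin \<alpha>)\<^sup>2"
      unfolding sin_squared_eq cos by (simp add: power2_eq_square algebra_simps)
    show "0 \<le> sin \<alpha>" using a0 a1 by (intro sin_ge_zero) auto
  qed
  then have "\<kappa> * q\<^sup>2 * q < \<kappa> * q\<^sup>2 * sin \<alpha>"
    using \<open>\<kappa> > 0\<close> q2 by (intro mult_strict_left_mono) auto
  then have strong: "Omega_inf \<omega> < \<kappa> * q\<^sup>2 * sin \<alpha>"
    using q by (simp add: power2_eq_square power3_eq_cube mult_ac)
  have "real CARD('n) * q\<^sup>2 < (\<Sum>i\<in>UNIV. 1 + cos (x $ i)) - real CARD('n) * q\<^sup>2"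
    using start by (simp add: algebra_simps)
  also have "\<dots> = (\<Sum>i\<in>UNIV. 1 + cos (x $ i) - (1 - cos \<alpha>))"
    by (simp add: cos sum_subtractf)
  also have "\<dots> \<le> (\<Sum>i\<in>UNIV. kept \<alpha> (x $ i))"
    using \<open>x \<in> cube\<close> a0 a1 by (intro sum_mono kept_ge) (auto simp: cube_def abs_le_iff minus_le_iff)
  finally have "q\<^sup>2 < order_R \<theta> t" if "t \<ge> 0" for t
    by (intro order_R_stays_large[OF sol \<open>\<kappa> > 0\<close> a0 a1 strong _ that])
  then show ?thesis
    by (intro osc_bounded_if_order_R_large[OF sol assms(2,3) a0 a1 strong]) (auto intro: less_imp_le)
qed

text \<open>The inequality between \<open>Omega_inf \<omega>\<close> and
  \<open>\<kappa> * q ^ 3\<close>, in place of equality, leaves \<open>q\<close> free to tend to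
  \<open>0\<close> when all frequencies vanish.\<close>

lemma norm_meas_osc_bounded_ge:
  fixes \<omega> :: "real^'n"
  assumes "\<kappa> > 0" "0 < q" "q < 1" "Omega_inf \<omega> \<le> \<kappa> * q ^ 3"
  shows "norm_meas {x \<in> cube. \<forall>\<theta>. is_solution \<kappa> \<omega> x \<theta> \<longrightarrow> (\<forall>i. osc_bounded \<theta> i)}
    \<ge> 1 - (sqrt (pi * exp 1 / 2) * q) ^ CARD('n)"
proof (rule norm_meas_ge_chernoff)
  show "(\<integral>\<^sup>+x. ennreal (exp (1 / (4 * q\<^sup>2) * (2 * q\<^sup>2 - (1 + cos x)))) * indicator {-pi..pi} x \<partial>lborel)
      \<le> ennreal (2 * pi * (sqrt (pi * exp 1 / 2) * q))"
    by (rule cos_chernoff_integral) fact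
qed (use assms osc_bounded_initial_data_in_borel osc_bounded_if_initially_spread in auto)

section \<open>The order parameter event and the two measure estimates\<close>

lemma order_R_lower_bound_in_borel:
  fixes \<omega> :: "real^'n"
  assumes "\<kappa> > 0"
  shows "{x \<in> cube. \<forall>\<theta>. is_solution \<kappa> \<omega> x \<theta> \<longrightarrow> (\<forall>t\<ge>0. order_R \<theta> t \<ge> r)} \<in> sets borel"
proof (rule initial_data_in_borel[OF assms], intro allI impI)
  fix \<Theta> :: "nat \<Rightarrow> real \<Rightarrow> real^'n" and \<theta> and t :: real
  assume large: "\<And>n. \<forall>t\<ge>0. order_R (\<Theta> n) t \<ge> r"
    and lim: "\<And>t. t \<ge> 0 \<Longrightarrow> (\<lambda>n. \<Theta> n t) \<longlonglongrightarrow> \<theta> t" and t: "t \<ge> 0"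
  have "(\<lambda>n. order_R (\<Theta> n) t) \<longlonglongrightarrow> order_R \<theta> t"
    unfolding order_R_def by (intro tendsto_intros lim t)
  then show "order_R \<theta> t \<ge> r"
    by (rule LIMSEQ_le_const) (use large t in auto)
qed

theorem theorem1p6:
  fixes \<omega> :: "real^'n" and \<kappa> \<epsilon> :: real
  assumes "\<kappa> > 0" and "0 < \<epsilon>" and "\<epsilon> \<le> 1"
    and "\<kappa> > (2 + \<epsilon>) * Omega_inf \<omega>"
  shows "(let S = {\<theta>0 \<in> cube. \<forall>\<theta>. is_solution \<kappa> \<omega> \<theta>0 \<theta> \<longrightarrow>
              (\<forall>t\<ge>0. order_R \<theta> t \<ge> 1 / sqrt 2 - 3 * \<epsilon> / 20)
            \<and> (\<forall>i. osc_bounded \<theta> i)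
            \<and> (\<forall>i. \<forall>t0\<ge>0. cos (\<theta> t0 $ i) \<ge> - 1 / sqrt 2 \<longrightarrow>
                  (\<forall>t\<ge>t0. cos (\<theta> t $ i) \<ge> - 1 / sqrt 2) \<and>
                  (\<forall>t\<ge>t0 + (2 + \<epsilon>) * pi / (\<kappa> - (2 + \<epsilon>) * Omega_inf \<omega>).
                      cos (\<theta> t $ i) \<ge> 1 / sqrt 2))}
         in S \<in> sets lebesgue \<and>
            norm_meas S \<ge> 1 - exp (- (\<epsilon>^2 * real CARD('n) / 25)))
       \<and> (\<kappa> > (pi * exp 1 / 2) powr (3/2) * Omega_inf \<omega> \<longrightarrow>
          (let S = {\<theta>0 \<in> cube. \<forall>\<theta>. is_solution \<kappa> \<omega> \<theta>0 \<theta> \<longrightarrow> (\<forall>i. osc_bounded \<theta> i)}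
           in S \<in> sets lebesgue \<and>
              norm_meas S \<ge> 1 - (sqrt (pi * exp 1 / 2) * Omega_inf \<omega> powr (1/3)
                                   / \<kappa> powr (1/3)) ^ CARD('n)))"
proof -
  define r where "r = 1 / sqrt 2 - 3 * \<epsilon> / 20"
  define S1 where "S1 = {x \<in> cube. \<forall>\<theta>. is_solution \<kappa> \<omega> x \<theta> \<longrightarrow> (\<forall>t\<ge>0. order_R \<theta> t \<ge> r)}"
  define S2 where "S2 = {x \<in> cube. \<forall>\<theta>. is_solution \<kappa> \<omega> x \<theta> \<longrightarrow> (\<forall>i. osc_bounded \<theta> i)}"
  \<comment> \<open>Described by the order parameter alone, the set is cut out by a weak inequality
    that passes to limits of solutions.\<close>
  have S1_eq: "{\<theta>0 \<in> cube. \<forall>\<theta>. is_solution \<kappa> \<omega> \<theta>0 \<theta> \<longrightarrow>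
              (\<forall>t\<ge>0. order_R \<theta> t \<ge> 1 / sqrt 2 - 3 * \<epsilon> / 20)
            \<and> (\<forall>i. osc_bounded \<theta> i)
            \<and> (\<forall>i. \<forall>t0\<ge>0. cos (\<theta> t0 $ i) \<ge> - 1 / sqrt 2 \<longrightarrow>
                  (\<forall>t\<ge>t0. cos (\<theta> t $ i) \<ge> - 1 / sqrt 2) \<and>
                  (\<forall>t\<ge>t0 + (2 + \<epsilon>) * pi / (\<kappa> - (2 + \<epsilon>) * Omega_inf \<omega>).
                      cos (\<theta> t $ i) \<ge> 1 / sqrt 2))} = S1"
    unfolding S1_def r_def
    using conditions_from_order_R[OF _ _ assms(1,2,3,4)] by blast
  have borel: "S1 \<in> sets borel" "S2 \<in> sets borel"
    unfolding S1_def S2_def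
    by (intro order_R_lower_bound_in_borel osc_bounded_initial_data_in_borel assms)+
  then have leb: "S1 \<in> sets lebesgue" "S2 \<in> sets lebesgue"
    by (auto intro: sets_completionI_sets)
  have "Omega_inf \<omega> < \<kappa> / (2 + \<epsilon>)" using assms by (simp add: field_simps)
  also have "\<dots> \<le> \<kappa> * r * sin (pi/4)" unfolding r_def by (intro threshold_margin assms)
  finally have strong: "Omega_inf \<omega> < \<kappa> * r * sin (pi/4)" .
  have "1 - exp (- (\<epsilon>\<^sup>2 / 25)) ^ CARD('n) \<le> norm_meas S1"
  proof (rule norm_meas_ge_chernoff)
    show "(\<integral>\<^sup>+x. ennreal (exp (1/4 * (r - kept (pi/4) x))) * indicator {-pi..pi} x \<partial>lborel)
        \<le> ennreal (2 * pi * exp (- (\<epsilon>\<^sup>2 / 25)))"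
      unfolding r_def by (rule kept_chernoff_integral) fact+
    show "x \<in> S1" if "x \<in> cube" "real CARD('n) * r < (\<Sum>i\<in>UNIV. kept (pi/4) (x $ i))" for x
      unfolding S1_def
      using order_R_stays_large[OF _ \<open>\<kappa> > 0\<close> _ _ strong that(2)] that(1) by (auto intro: less_imp_le)
  qed (use borel in \<open>auto simp: S1_def\<close>)
  also have "exp (- (\<epsilon>\<^sup>2 / 25)) ^ CARD('n) = exp (- (\<epsilon>^2 * real CARD('n) / 25))"
    by (simp add: mult_ac flip: exp_of_nat_mult)
  finally have part1: "norm_meas S1 \<ge> 1 - exp (- (\<epsilon>^2 * real CARD('n) / 25))" .
  define q where "q = Omega_inf \<omega> powr (1/3) / \<kappa> powr (1/3)"
  have Om: "Omega_inf \<omega> \<ge> 0" using abs_le_Omega_inf[of \<omega> undefined] by linarith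
  have part2: "norm_meas S2 \<ge> 1 - (sqrt (pi * exp 1 / 2) * q) ^ CARD('n)"
  proof (cases "Omega_inf \<omega> = 0")
    case True
    \<comment> \<open>Vanishing frequencies would mean \<open>q = 0\<close>; the estimate holds for
      every \<open>q\<close> between \<open>0\<close> and \<open>1\<close>, so let \<open>q\<close>
      tend to \<open>0\<close> from the right.\<close>
    have "((\<lambda>q. 1 - (sqrt (pi * exp 1 / 2) * q) ^ CARD('n)) \<longlongrightarrow>
        1 - (sqrt (pi * exp 1 / 2) * 0) ^ CARD('n)) (at_right 0)"
      by (intro tendsto_intros)
    moreover have "\<forall>\<^sub>F q in at_right 0. 1 - (sqrt (pi * exp 1 / 2) * q) ^ CARD('n) \<le> norm_meas S2"
      using eventually_at_right_real[OF zero_less_one]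
    proof eventually_elim
      case (elim q)
      then show ?case
        unfolding S2_def using True \<open>\<kappa> > 0\<close> by (intro norm_meas_osc_bounded_ge) auto
    qed
    ultimately have "1 - (sqrt (pi * exp 1 / 2) * 0) ^ CARD('n) \<le> norm_meas S2"
      by (rule tendsto_upperbound) simp
    then show ?thesis using True by (simp add: q_def)
  next
    case False
    then have pos: "Omega_inf \<omega> > 0" using Om by simp
    have q_eq: "q = (Omega_inf \<omega> / \<kappa>) powr (1/3)"
      using pos \<open>\<kappa> > 0\<close> by (simp add: q_def powr_divide)
    have "q ^ 3 = Omega_inf \<omega> / \<kappa>"
      unfolding q_eq using pos \<open>\<kappa> > 0\<close> by (simp add: powr_powr flip: powr_realpow)
    then have "Omega_inf \<omega> \<le> \<kappa> * q ^ 3" using \<open>\<kappa> > 0\<close> by simp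
    moreover have "Omega_inf \<omega> < \<kappa>"
      using assms mult_right_mono[of 1 "2 + \<epsilon>" "Omega_inf \<omega>"] Om by linarith
    then have "q < 1" unfolding q_eq using pos \<open>\<kappa> > 0\<close> powr_less_mono2[of "1/3" "Omega_inf \<omega> / \<kappa>" 1] by simp
    moreover have "0 < q" unfolding q_eq using pos \<open>\<kappa> > 0\<close> by simp
    ultimately show ?thesis
      unfolding S2_def using \<open>\<kappa> > 0\<close> by (intro norm_meas_osc_bounded_ge)
  qed
  have "sqrt (pi * exp 1 / 2) * Omega_inf \<omega> powr (1/3) / \<kappa> powr (1/3) = sqrt (pi * exp 1 / 2) * q"
    by (simp add: q_def)
  then show ?thesis
    unfolding S1_eq Let_def S2_def[symmetric] using leb part1 part2 by simp
qed

end
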